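(* Let $\rho\in[0,1)$ and let $(X,Y)$ be a bivariate random vector with $$(X,Y)\stackrel{d}{=}(RI_1W,\ \rho RI_1W+RI_2z^*(W)),$$ where $(I_1,I_2)$, $R>0$ and $W\in(0,1)$ are mutually independent, $I_1,I_2$ take values in $\{-1,1\}$ with $P\{I_1=I_2=1\}\in(0,1]$, $z^*:[0,1]\to[0,1]$ is a positive measurable function, $R$ has distribution function $F$ with infinite upper endpoint, $F\in GMDA(w)$ for some positive scaling function $w$, and the distribution function of $W$ has upper endpoint $1$. Put $z(x):=\rho x+z^*(x)$ and suppose $z(x)\le1$ and $z^*(x)\le b<1$ for all $x\in[0,1]$. Suppose that for some $\gamma_1,\gamma_2\in[0,\infty)$ $$\lim_{x\to\infty}\frac{P\{W>1-s/x\}}{P\{W>1-1/x\}}=s^{\gamma_1},\qquad \lim_{x\to\infty}\frac{P\{z(W)>1-s/x\}}{P\{z(W)>1-1/x\}}=s^{\gamma_2},\qquad\forall s>0.$$ Then both $X$ and $Y$ have distribution functions in the Gumbel max-domain of attraction with the same scaling function $w$. Suppose in addition that for some $a\in(0,1]$ the following holds: there exist $a_\rho\in(1,a/|\rho|)$ and $\varepsilon\in(0,1)$ such that $z$ is decreasing in $V_\varepsilon:=[1/a_\rho-\varepsilon,1/a_\rho+\varepsilon]$, $z(x)\le a/a_\rho$ for all $x\in(1/a_\rho,1]$, the inverse $z_\varepsilon$ of $z$ in $V_\varepsilon$ satisfies $z_\varepsilon(a/a_\rho-d/x)-1/a_\rho\sim cd/x$ as $x\to\infty$, locally uniformly for $d>0$,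 with some $c\in(0,\infty)$, and, with $K_1:=-1/a_\rho$, $K_2:=ca/a_\rho$, $P\{W-1/a_\rho\in(K_1u,K_2u)\}\sim L_{K_1,K_2}(u)u^{\gamma_a}$ as $u\downarrow0$ for some $\gamma_a\in[0,\infty)$ and some locally bounded function $L_{K_1,K_2}$ slowly varying at $0$. Then, with $G_1,G_2$ the distribution functions of $X$ and $Y$, $$l(s,t):=\lim_{x\to\infty}\frac{P\{G_1(X)>1-s/x,\ G_2(Y)>1-t/x\}}{\min\bigl(P\{G_1(X)>1-s/x\},\,P\{G_2(Y)>1-t/x\}\bigr)}=0,\qquad\forall s,t\in(0,\infty).$$ Consequently $X$ and $Y$ are asymptotically independent, and the distribution function of $(X,Y)$ is in the max-domain of attraction of the bivariate product distribution with unit Gumbel marginals.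
   Context: $\overline F:=1-F$. For a distribution function $H$ with infinite upper endpoint, $H\in GMDA(w)$ (Gumbel max-domain of attraction with positive scaling function $w$) means $\lim_{x\to\infty}(1-H(x+t/w(x)))/(1-H(x))=e^{-t}$ for all $t\in\mathbb R$. $f\sim g$ means that the ratio $f/g$ tends to $1$ in the indicated limit. If $\rho=0$, $a/|\rho|$ is read as $+\infty$. $X$ and $Y$ are called asymptotically independent if $l(1,1)=0$. The unit Gumbel distribution function is $\exp(-e^{-x})$, $x\in\mathbb R$. $\stackrel{d}{=}$ denotes equality in distribution. *)

theory Defs
  imports "HOL-Probability.Probability"
begin

definition distr_fun :: "'a measure \<Rightarrow> ('a \<Rightarrow> real) \<Rightarrow> real \<Rightarrow> real" where
  "distr_fun M X = cdf (distr M borel X)"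

definition joint_distr_fun ::
    "'a measure \<Rightarrow> ('a \<Rightarrow> real) \<Rightarrow> ('a \<Rightarrow> real) \<Rightarrow> real \<Rightarrow> real \<Rightarrow> real" where
  "joint_distr_fun M X Y x y = \<P>(\<omega> in M. X \<omega> \<le> x \<and> Y \<omega> \<le> y)"

definition upper_endpoint :: "(real \<Rightarrow> real) \<Rightarrow> ereal" where
  "upper_endpoint H = (SUP x \<in> {x. H x < 1}. ereal x)"

text \<open>Only the behaviour of the scaling function at infinity matters, so positivity is asked
  for large arguments; this admits, e.g., \<open>w x = x\<close> for the normal distribution.\<close>

definition gumbel_mda :: "(real \<Rightarrow> real) \<Rightarrow> (real \<Rightarrow> real) \<Rightarrow> bool" where
  "gumbel_mda w H \<longleftrightarrow>
     upper_endpoint H = \<infinity> \<and>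
     (\<forall>\<^sub>F x in at_top. 0 < w x) \<and>
     (\<forall>t. ((\<lambda>x. (1 - H (x + t / w x)) / (1 - H x)) \<longlongrightarrow> exp (- t)) at_top)"

text \<open>Mutual independence of three random variables with possibly different value types:
  \<open>indep_vars\<close> from the library requires a common value type, so its definition is written out
  on the generated families of events.\<close>

definition indep_vars3 ::
    "'a measure \<Rightarrow> 'b measure \<Rightarrow> ('a \<Rightarrow> 'b) \<Rightarrow> 'c measure \<Rightarrow> ('a \<Rightarrow> 'c) \<Rightarrow>
     'd measure \<Rightarrow> ('a \<Rightarrow> 'd) \<Rightarrow> bool" where
  "indep_vars3 M A X B Y C Z \<longleftrightarrow>
     X \<in> measurable M A \<and> Y \<in> measurable M B \<and> Z \<in> measurable M C \<and>
     prob_space.indep_sets M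
       (\<lambda>i. if i = 0 then {X -` S \<inter> space M | S. S \<in> sets A}
            else if i = 1 then {Y -` S \<inter> space M | S. S \<in> sets B}
            else {Z -` S \<inter> space M | S. S \<in> sets C})
       {0, 1, 2 :: nat}"

definition locally_bounded_on :: "real set \<Rightarrow> (real \<Rightarrow> real) \<Rightarrow> bool" where
  "locally_bounded_on S L \<longleftrightarrow> (\<forall>K. compact K \<and> K \<subseteq> S \<longrightarrow> bounded (L ` K))"

definition slowly_varying_at_0 :: "(real \<Rightarrow> real) \<Rightarrow> bool" where
  "slowly_varying_at_0 L \<longleftrightarrow>
     (\<forall>\<^sub>F u in at_right 0. 0 < L u) \<and>
     (\<forall>t>0. ((\<lambda>u. L (t * u) / L u) \<longlongrightarrow> 1) (at_right 0))"

text \<open>The quotient whose limit as \<open>x \<rightarrow> \<infinity>\<close> is \<open>l(s,t)\<close>.\<close>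

definition tail_ratio ::
    "'a measure \<Rightarrow> ('a \<Rightarrow> real) \<Rightarrow> ('a \<Rightarrow> real) \<Rightarrow> real \<Rightarrow> real \<Rightarrow> real \<Rightarrow> real" where
  "tail_ratio M X Y s t x =
     \<P>(\<omega> in M. distr_fun M X (X \<omega>) > 1 - s / x \<and> distr_fun M Y (Y \<omega>) > 1 - t / x) /
     min \<P>(\<omega> in M. distr_fun M X (X \<omega>) > 1 - s / x)
         \<P>(\<omega> in M. distr_fun M Y (Y \<omega>) > 1 - t / x)"

definition asymptotically_independent ::
    "'a measure \<Rightarrow> ('a \<Rightarrow> real) \<Rightarrow> ('a \<Rightarrow> real) \<Rightarrow> bool" where
  "asymptotically_independent M X Y \<longleftrightarrow> (tail_ratio M X Y 1 1 \<longlongrightarrow> 0) at_top"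

definition gumbel :: "real \<Rightarrow> real" where
  "gumbel x = exp (- exp (- x))"

text \<open>Convergence is required at every point, which is weak convergence when the limit
  distribution function \<open>Q\<close> is continuous.\<close>

definition bivariate_mda :: "(real \<Rightarrow> real \<Rightarrow> real) \<Rightarrow> (real \<Rightarrow> real \<Rightarrow> real) \<Rightarrow> bool" where
  "bivariate_mda Q H \<longleftrightarrow>
     (\<exists>a1 b1 a2 b2 :: nat \<Rightarrow> real.
        (\<forall>n. 0 < a1 n \<and> 0 < a2 n) \<and>
        (\<forall>x y. (\<lambda>n. H (a1 n * x + b1 n) (a2 n * y + b2 n) ^ n) \<longlonglongrightarrow> Q x y))"

end

theory Submission
  imports Defs
begin

text \<open>
  Write \<open>a = 1 / w\<close> and \<open>T = 1 - F\<close>. If \<open>S\<close> with values in \<open>(0, 1]\<close> is independent of \<open>R\<close>, then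
  \<open>P(R S > x) = E T(x / S)\<close>. Where \<open>x / S \<le> x + K a(x)\<close>, replacing \<open>x\<close> by \<open>x + t a(x)\<close> multiplies
  \<open>T(x / S)\<close> by \<open>exp (- t)\<close> up to a uniformly small relative error, and regular variation of
  \<open>P(S > 1 - \<cdot>)\<close> at \<open>0\<close> makes the complementary part negligible for large \<open>K\<close>, uniformly in \<open>x\<close>. So \<open>R S\<close>
  is again in the Gumbel domain with scaling \<open>w\<close>. This applies to \<open>S = W\<close> and \<open>S = z(W)\<close>; the other
  sign combinations contribute to \<open>Y\<close> at most \<open>T(q x)\<close> with \<open>q > 1\<close>, which is negligible because \<open>T\<close>
  is rapidly varying.

  A joint exceedance of \<open>u\<close> by \<open>X\<close> and of \<open>v\<close> by \<open>Y\<close> forces \<open>R > q u\<close> or \<open>R > q v\<close> for a fixed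
  \<open>q > 1\<close>, according to whether \<open>W \<le> 1 / a\<^sub>\<rho>\<close> or not. Hence its probability is negligible compared
  with the sum of the two marginal tails.
\<close>

text \<open>\<open>T (x + v * a x) / T x\<close> converges uniformly only for \<open>v\<close> in
  compact sets, while \<open>x / S\<close> makes \<open>v\<close> unbounded. What is cut off beyond
  \<open>x + K * a x\<close> must be small against \<open>E T(x / S)\<close> itself, which may be
  far smaller than \<open>T x\<close>: the lower bound at hand is a constant times
  \<open>T x * G (a x / x / 2)\<close>, with \<open>G \<tau>\<close> the probability of
  \<open>S > 1 - \<tau>\<close>. So the decay of \<open>T\<close> has to beat the growth of
  \<open>G\<close>. A step of length \<open>a\<close> multiplies \<open>T\<close> by about
  \<open>exp (- 1) < 1 / 2\<close>, and regular variation lets the argument of \<open>G\<close> grow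
  by some \<open>l > 1\<close> at the price of a factor \<open>3 / 2\<close>; any price below
  \<open>2\<close> would do.

  The second obstacle is atoms: \<open>T u = p\<close> need not be solvable, and
  \<open>distr_fun M X (X \<omega>)\<close> need not be uniform. Quantiles are therefore described
  by one-sided inequalities, and joint exceedances are bounded for the larger events with
  \<open>\<le>\<close>.

  A factor \<open>q > 1\<close> in the argument of \<open>T\<close> beats every multiple
  \<open>K * a x\<close>, because \<open>a\<close> is sublinear, and so outweighs all
  constants.\<close>

section \<open>Tails in the Gumbel domain of attraction\<close>

text \<open>Positivity of \<open>T\<close> at every point encodes the infinite upper endpoint. A
  bare function is used instead of a distribution so that the expectation
  \<open>product_tail\<close> can take the place of \<open>T\<close>.\<close>

locale gumbel_tail =
  fixes a T :: "real \<Rightarrow> real"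
  assumes antimono_T: "antimono T"
    and T_pos: "0 < T x"
    and T_le_one: "T x \<le> 1"
    and T_vanish: "(T \<longlongrightarrow> 0) at_top"
    and scale_pos: "\<forall>\<^sub>F x in at_top. 0 < a x"
    and T_ratio: "((\<lambda>x. T (x + t * a x) / T x) \<longlongrightarrow> exp (- t)) at_top"
begin

section \<open>Growth and self-neglect of the scale\<close>

lemma T_mono: "x \<le> y \<Longrightarrow> T y \<le> T x"
  using antimono_T by (rule antimonoD)

text \<open>If \<open>a x\<close> exceeded \<open>e * x\<close>, the point
  \<open>x - a x / e\<close> would be nonpositive and \<open>T\<close> there at least
  \<open>T 0\<close>. But that value is about \<open>exp (1 / e) * T x\<close>, which tends to
  \<open>0\<close>.\<close>

lemma scale_sublinear:
  assumes "0 < e"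
  shows "\<forall>\<^sub>F x in at_top. a x \<le> e * x"
proof -
  define B where "B = exp (1 / e) + 1"
  have B: "0 < B" unfolding B_def by (simp add: add_pos_pos)
  have "\<forall>\<^sub>F x in at_top. T (x + (- (1 / e)) * a x) / T x < B"
    using T_ratio[of "- (1 / e)"] by (rule order_tendstoD) (simp add: B_def)
  moreover have "\<forall>\<^sub>F x in at_top. T x < T 0 / B"
    using T_vanish by (rule order_tendstoD) (simp add: B T_pos)
  ultimately show ?thesis
  proof eventually_elim
    case (elim x)
    show ?case
    proof (rule ccontr)
      assume "\<not> a x \<le> e * x"
      then have "x + (- (1 / e)) * a x \<le> 0"
        using assms by (simp add: field_simps)
      then have "T 0 \<le> T (x + (- (1 / e)) * a x)"
        by (rule T_mono)
      also have "\<dots> < B * T x"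
        using elim(1) T_pos[of x] by (simp add: field_simps)
      also have "\<dots> < T 0"
        using elim(2) B by (simp add: field_simps)
      finally show False .
    qed
  qed
qed

lemma scale_over_arg_tendsto: "((\<lambda>x. a x / x) \<longlongrightarrow> 0) at_top"
proof (rule order_tendstoI)
  fix l :: real assume "l < 0"
  show "\<forall>\<^sub>F x in at_top. l < a x / x"
    using scale_pos eventually_gt_at_top[of 0]
  proof eventually_elim
    case (elim x)
    then have "0 < a x / x" by simp
    with \<open>l < 0\<close> show ?case by linarith
  qed
next
  fix u :: real assume "0 < u"
  then have "\<forall>\<^sub>F x in at_top. a x \<le> u / 2 * x"
    by (intro scale_sublinear) simp
  then show "\<forall>\<^sub>F x in at_top. a x / x < u"
    using eventually_gt_at_top[of 0]
  proof eventually_elim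
    case (elim x)
    then have "a x / x \<le> u / 2" by (simp add: field_simps)
    with \<open>0 < u\<close> show ?case by linarith
  qed
qed

lemma filterlim_shift: "filterlim (\<lambda>x. x + t * a x) at_top at_top"
proof -
  \<comment> \<open>Chosen so that the shift moves \<open>x\<close> by at most half of its
    size.\<close>
  define e where "e = 1 / (2 * (\<bar>t\<bar> + 1))"
  have e: "0 < e" "\<bar>t\<bar> * e \<le> 1 / 2"
    unfolding e_def by (auto simp: field_simps)
  have "\<forall>\<^sub>F x in at_top. (1 / 2) * x \<le> x + t * a x"
    using scale_sublinear[OF e(1)] scale_pos eventually_ge_at_top[of 0]
  proof eventually_elim
    case (elim x)
    have "\<bar>t * a x\<bar> \<le> \<bar>t\<bar> * (e * x)"
      using elim by (simp add: abs_mult mult_left_mono)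
    also have "\<dots> \<le> 1 / 2 * x"
      using e(2) elim(3) mult_right_mono[of "\<bar>t\<bar> * e" "1/2" x] by (simp add: mult.assoc)
    finally show ?case by (simp add: abs_le_iff)
  qed
  moreover have "filterlim (\<lambda>x::real. (1 / 2) * x) at_top at_top"
    by (rule filterlim_tendsto_pos_mult_at_top[OF tendsto_const _ filterlim_ident]) simp
  ultimately show ?thesis
    by (rule filterlim_at_top_mono[rotated])
qed

text \<open>Monotone functions converging pointwise to a continuous limit converge uniformly on
  compact sets: near \<open>v\<close> the ratio is squeezed between its values at
  \<open>v - h\<close> and \<open>v + h\<close>, and finitely many such neighbourhoods cover the
  interval.\<close>

lemma T_ratio_locally_uniform:
  assumes "0 < e"
  shows "\<forall>\<^sub>F x in at_top. \<forall>v\<in>{l..u}. \<bar>T (x + v * a x) / T x - exp (- v)\<bar> < e"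
proof -
  have near: "\<exists>U. open U \<and> v \<in> U \<and>
     (\<forall>\<^sub>F x in at_top. \<forall>v'\<in>U. \<bar>T (x + v' * a x) / T x - exp (- v')\<bar> < e)" for v
  proof -
    have "isCont (\<lambda>v. exp (- v)) v" by (intro continuous_intros)
    then have "\<exists>d>0. \<forall>y. dist y v < d \<longrightarrow> dist (exp (- y)) (exp (- v)) < e / 4"
      using assms unfolding continuous_at_eps_delta
      by (metis zero_less_divide_iff zero_less_numeral)
    then obtain d where d: "d > 0" "\<And>y. \<bar>y - v\<bar> < d \<Longrightarrow> \<bar>exp (- y) - exp (- v)\<bar> < e / 4"
      by (auto simp: dist_real_def)
    define h where "h = d / 2"
    have h: "0 < h" "h < d" using d(1) by (auto simp: h_def)
    have hl: "\<bar>exp (- (v - h)) - exp (- v)\<bar> < e / 4" "\<bar>exp (- (v + h)) - exp (- v)\<bar> < e / 4"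
      using d(2)[of "v - h"] d(2)[of "v + h"] h by auto
    have "\<forall>\<^sub>F x in at_top. T (x + (v - h) * a x) / T x < exp (- (v - h)) + e / 4"
      using T_ratio[of "v - h"] by (rule order_tendstoD) (use assms in simp)
    moreover have "\<forall>\<^sub>F x in at_top. exp (- (v + h)) - e / 4 < T (x + (v + h) * a x) / T x"
      using T_ratio[of "v + h"] by (rule order_tendstoD) (use assms in simp)
    ultimately have "\<forall>\<^sub>F x in at_top. \<forall>v'\<in>{v - h<..<v + h}.
        \<bar>T (x + v' * a x) / T x - exp (- v')\<bar> < e"
      using scale_pos
    proof eventually_elim
      case (elim x)
      show ?case
      proof
        fix v' assume v': "v' \<in> {v - h<..<v + h}"
        have "T (x + (v + h) * a x) / T x \<le> T (x + v' * a x) / T x"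
          "T (x + v' * a x) / T x \<le> T (x + (v - h) * a x) / T x"
          using v' elim(3) T_pos[of x]
          by (auto intro!: divide_right_mono T_mono mult_right_mono)
        moreover have "\<bar>exp (- v') - exp (- v)\<bar> < e / 4"
          using v' h by (intro d(2)) auto
        ultimately show "\<bar>T (x + v' * a x) / T x - exp (- v')\<bar> < e"
          using elim(1,2) hl assms by (simp only: abs_less_iff) linarith
      qed
    qed
    then show ?thesis
      using h by (intro exI[of _ "{v - h<..<v + h}"]) auto
  qed
  define F where "F = {U. open U \<and>
     (\<forall>\<^sub>F x in at_top. \<forall>v'\<in>U. \<bar>T (x + v' * a x) / T x - exp (- v')\<bar> < e)}"
  have "{l..u} \<subseteq> \<Union>F"
  proof
    fix v
    obtain U where "open U" "v \<in> U"
      "\<forall>\<^sub>F x in at_top. \<forall>v'\<in>U. \<bar>T (x + v' * a x) / T x - exp (- v')\<bar> < e"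
      using near[of v] by (elim exE conjE)
    then show "v \<in> \<Union>F"
      unfolding F_def by (intro UnionI[of U] CollectI conjI)
  qed
  then obtain C where C: "C \<subseteq> F" "finite C" "{l..u} \<subseteq> \<Union>C"
    using compactE[of "{l..u}" F] unfolding F_def by (metis (no_types, lifting) compact_Icc mem_Collect_eq)
  have "\<forall>\<^sub>F x in at_top. \<forall>U\<in>C. \<forall>v'\<in>U. \<bar>T (x + v' * a x) / T x - exp (- v')\<bar> < e"
    using C(1,2) by (intro eventually_ball_finite) (auto simp: F_def)
  then show ?thesis
  proof eventually_elim
    case (elim x)
    then show ?case using C(3) by auto
  qed
qed

text \<open>With \<open>y = x + t * a x\<close>, two ratio limits in succession give
  \<open>T (y + a y) / T x\<close> the limit \<open>exp (- (t + 1))\<close>. By monotonicity of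
  \<open>T\<close>, the point \<open>y + a y\<close> is then trapped between
  \<open>x + (t + 1 - e) * a x\<close> and \<open>x + (t + 1 + e) * a x\<close>.\<close>

lemma scale_self_neglecting: "((\<lambda>x. a (x + t * a x) / a x) \<longlongrightarrow> 1) at_top"
proof (rule tendstoI)
  fix e :: real assume "0 < e"
  have lim: "((\<lambda>x. T ((x + t * a x) + s * a (x + t * a x)) / T (x + t * a x)
                * (T (x + t * a x) / T x)) \<longlongrightarrow> exp (- s) * exp (- t)) at_top" for s
    by (intro tendsto_mult T_ratio filterlim_compose[OF T_ratio[of s] filterlim_shift])
  then have lim1: "((\<lambda>x. T ((x + t * a x) + a (x + t * a x)) / T x) \<longlongrightarrow> exp (- (t + 1))) at_top"
    using lim[of 1] T_pos by (simp add: exp_add[symmetric] less_imp_neq[THEN not_sym] add.commute)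
  have up: "exp (- (t + 1 + e)) < exp (- (t + 1))" "exp (- (t + 1)) < exp (- (t + 1 - e))"
    using \<open>0 < e\<close> by auto
  \<comment> \<open>Numbers separating the three limits; they yield strict inequalities between
    values of \<open>T\<close>, which monotonicity turns back into inequalities between
    arguments.\<close>
  obtain m1 m2 where m: "exp (- (t + 1 + e)) < m1" "m1 < exp (- (t + 1))"
     "exp (- (t + 1)) < m2" "m2 < exp (- (t + 1 - e))"
    using up dense by metis
  have "\<forall>\<^sub>F x in at_top. T (x + (t + 1 + e) * a x) / T x < m1"
    using T_ratio by (rule order_tendstoD) (rule m)
  moreover have "\<forall>\<^sub>F x in at_top. m2 < T (x + (t + 1 - e) * a x) / T x"
    using T_ratio by (rule order_tendstoD) (rule m)
  moreover have "\<forall>\<^sub>F x in at_top. m1 < T ((x + t * a x) + a (x + t * a x)) / T x"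
    using lim1 by (rule order_tendstoD) (rule m)
  moreover have "\<forall>\<^sub>F x in at_top. T ((x + t * a x) + a (x + t * a x)) / T x < m2"
    using lim1 by (rule order_tendstoD) (rule m)
  ultimately show "\<forall>\<^sub>F x in at_top. dist (a (x + t * a x) / a x) 1 < e"
    using scale_pos
  proof eventually_elim
    case (elim x)
    let ?y = "(x + t * a x) + a (x + t * a x)"
    have less: "T (x + (t + 1 + e) * a x) < T ?y" "T ?y < T (x + (t + 1 - e) * a x)"
      using elim(1-4) T_pos[of x] by (auto simp: divide_less_eq less_divide_eq)
    have "?y < x + (t + 1 + e) * a x" "x + (t + 1 - e) * a x < ?y"
      using less T_mono[of "x + (t + 1 + e) * a x" ?y] T_mono[of ?y "x + (t + 1 - e) * a x"]
      by linarith+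
    then have "a (x + t * a x) < (1 + e) * a x" "(1 - e) * a x < a (x + t * a x)"
      by (auto simp: algebra_simps)
    then have "a (x + t * a x) / a x < 1 + e" "1 - e < a (x + t * a x) / a x"
      using elim(5) by (simp_all add: divide_less_eq less_divide_eq)
    then show ?case
      by (simp add: dist_real_def abs_less_iff)
  qed
qed

text \<open>For every \<open>K\<close> the point \<open>q * x\<close> eventually lies beyond
  \<open>x + K * a x\<close>, so the ratio is asymptotically at most
  \<open>exp (- K)\<close>.\<close>

lemma T_rapidly_varying:
  assumes "1 < q"
  shows "((\<lambda>x. T (q * x) / T x) \<longlongrightarrow> 0) at_top"
proof (rule order_tendstoI)
  fix l :: real assume "l < 0"
  then show "\<forall>\<^sub>F x in at_top. l < T (q * x) / T x"
    using T_pos by (intro always_eventually allI) (meson divide_pos_pos less_trans)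
next
  fix e :: real assume "0 < e"
  obtain K where K: "0 < K" "exp (- K) < e"
  proof -
    have "((\<lambda>K::real. exp (- K)) \<longlongrightarrow> 0) at_top"
      by (rule filterlim_compose[OF exp_at_bot filterlim_uminus_at_bot_at_top])
    then have "\<forall>\<^sub>F K::real in at_top. exp (- K) < e \<and> 0 < K"
      using \<open>0 < e\<close> by (intro eventually_conj order_tendstoD(2) eventually_gt_at_top)
    then have "\<exists>K. exp (- K) < e \<and> 0 < K"
      using eventually_happens' trivial_limit_at_top_linorder by blast
    then show ?thesis using that by blast
  qed
  have "\<forall>\<^sub>F x in at_top. T (x + K * a x) / T x < e"
    using T_ratio[of K] by (rule order_tendstoD) (rule K)
  moreover have "\<forall>\<^sub>F x in at_top. a x \<le> (q - 1) / K * x"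
    using assms K by (intro scale_sublinear) auto
  ultimately show "\<forall>\<^sub>F x in at_top. T (q * x) / T x < e"
  proof eventually_elim
    case (elim x)
    have "x + K * a x \<le> q * x"
      using elim(2) K(1) by (simp add: field_simps)
    then have "T (q * x) / T x \<le> T (x + K * a x) / T x"
      using T_pos[of x] by (intro divide_right_mono T_mono) auto
    then show ?case using elim(1) by linarith
  qed
qed

text \<open>Made for the two marginals: a product tail weighted by a sign probability, plus a
  remainder of smaller order. The decomposition is asked at nonnegative levels, where
  \<open>tail_U\<close> provides it; positivity of \<open>B\<close> further left follows from
  monotonicity.\<close>

lemma gumbel_tail_perturb:
  assumes "antimono B" "\<And>x. B x \<le> 1" "0 < p"
    and B: "\<And>x. 0 \<le> x \<Longrightarrow> B x = p * T x + r x" and r_nonneg: "\<And>x. 0 \<le> x \<Longrightarrow> 0 \<le> r x"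
    and r: "((\<lambda>x. r x / T x) \<longlongrightarrow> 0) at_top"
  shows "gumbel_tail a B"
proof
  show "antimono B" "B x \<le> 1" for x by fact+
  have Bpos: "0 < B x" if "0 \<le> x" for x
    using B[OF that] r_nonneg[OF that] T_pos[of x] \<open>0 < p\<close> by (simp add: add_pos_nonneg)
  show "0 < B x" for x
    using Bpos[of "max 0 x"] antimonoD[OF \<open>antimono B\<close>, of x "max 0 x"] by linarith
  have BT: "((\<lambda>x. B x / T x) \<longlongrightarrow> p) at_top"
  proof (rule Lim_transform_eventually)
    show "((\<lambda>x. p + r x / T x) \<longlongrightarrow> p) at_top"
      using tendsto_add[OF tendsto_const r, of p] by simp
    show "\<forall>\<^sub>F x in at_top. p + r x / T x = B x / T x"
      using eventually_ge_at_top[of 0] by eventually_elim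
        (use T_pos in \<open>simp add: B add_divide_distrib less_imp_neq[THEN not_sym]\<close>)
  qed
  have "((\<lambda>x. B x / T x * T x) \<longlongrightarrow> p * 0) at_top"
    by (intro tendsto_mult BT T_vanish)
  then show "(B \<longlongrightarrow> 0) at_top"
    using T_pos by (simp add: less_imp_neq[THEN not_sym])
  show "\<forall>\<^sub>F x in at_top. 0 < a x" by (rule scale_pos)
  fix t
  have "((\<lambda>x. B (x + t * a x) / T (x + t * a x) * (T (x + t * a x) / T x) / (B x / T x))
     \<longlongrightarrow> p * exp (- t) / p) at_top"
    using \<open>0 < p\<close>
    by (intro tendsto_divide tendsto_mult T_ratio filterlim_compose[OF BT filterlim_shift] BT) auto
  then show "((\<lambda>x. B (x + t * a x) / B x) \<longlongrightarrow> exp (- t)) at_top"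
    using T_pos \<open>0 < p\<close> by (simp add: less_imp_neq[THEN not_sym])
qed

section \<open>Relative error after rescaling the argument\<close>

lemma T_measurable [measurable]: "T \<in> borel_measurable borel"
proof -
  have "mono (\<lambda>x. - T x)"
    using T_mono by (intro monoI) auto
  then have "(\<lambda>x. - (- T x)) \<in> borel_measurable borel"
    by (intro borel_measurable_uminus borel_measurable_mono)
  then show ?thesis by simp
qed

text \<open>Here \<open>y\<close> stands for \<open>x / S\<close>. Writing
  \<open>y = x + v * a x\<close> turns the rescaled argument into
  \<open>x + (v + t + h) * a x\<close> with the cross term \<open>h = t * v * (a x / x)\<close>,
  which vanishes because \<open>a\<close> is sublinear. The error is measured against
  \<open>T y\<close>, not \<open>T x\<close>, so that integrating over \<open>S\<close> gives an
  error relative to \<open>product_tail x\<close>.\<close>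

lemma T_ratio_rescaled_uniform:
  assumes "0 < e" "0 \<le> K"
  shows "\<forall>\<^sub>F x in at_top. \<forall>y\<in>{x..x + K * a x}.
           \<bar>T ((x + t * a x) / x * y) - exp (- t) * T y\<bar> \<le> e * T y"
proof -
  define e' where "e' = min e 1"
  have e': "0 < e'" "e' \<le> e" "e' \<le> 1" using assms by (auto simp: e'_def)
  \<comment> \<open>Since \<open>e' \<le> 1\<close>, \<open>\<delta>\<close> is at most
    \<open>exp (- K) / 2\<close>, which keeps \<open>T y / T x\<close> above
    \<open>exp (- K) / 2\<close>. The divisor \<open>6\<close> lets three errors of size
    \<open>exp \<bar>t\<bar> * \<delta>\<close> add up to \<open>e' * exp (- K) / 2\<close>.\<close>
  define \<delta> where "\<delta> = e' * exp (- \<bar>t\<bar> - K) / 6"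
  have \<delta>: "0 < \<delta>" using e' by (simp add: \<delta>_def)
  have \<delta>_le: "\<delta> \<le> exp (- K) / 2"
  proof -
    have "e' * exp (- \<bar>t\<bar> - K) \<le> 1 * exp (- K)"
      using e' by (intro mult_mono) auto
    then show ?thesis
      unfolding \<delta>_def using exp_gt_zero[of "-K"] by linarith
  qed
  \<comment> \<open>Bounds \<open>v + t + h\<close> when \<open>0 \<le> v \<le> K\<close> and
    \<open>\<bar>h\<bar> \<le> \<bar>t\<bar>\<close>.\<close>
  define M where "M = K + 2 * \<bar>t\<bar>"
  have "isCont (\<lambda>h::real. exp (- h)) 0" by (intro continuous_intros)
  then obtain d where d: "0 < d" "\<And>h::real. \<bar>h\<bar> < d \<Longrightarrow> \<bar>exp (- h) - 1\<bar> < \<delta>"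
    unfolding continuous_at_eps_delta using \<delta> by (force simp: dist_real_def)
  have Kt: "0 < d / (\<bar>t\<bar> * K + 1)" "0 < 1 / (K + 1)"
    using d(1) assms(2) by (auto intro!: divide_pos_pos add_nonneg_pos)
  have "\<forall>\<^sub>F x in at_top. a x / x < d / (\<bar>t\<bar> * K + 1)"
    "\<forall>\<^sub>F x in at_top. a x / x < 1 / (K + 1)"
    using scale_over_arg_tendsto Kt by (auto intro: order_tendstoD)
  then show ?thesis
    using T_ratio_locally_uniform[OF \<delta>, of "-M" M] scale_pos eventually_gt_at_top[of 0]
  proof eventually_elim
    case (elim x)
    show ?case
    proof
      fix y assume y: "y \<in> {x..x + K * a x}"
      define v where "v = (y - x) / a x"
      have v: "0 \<le> v" "v \<le> K" "y = x + v * a x"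
        using y elim(4) by (auto simp: v_def divide_le_eq)
      define h where "h = t * v * (a x / x)"
      have vx: "0 \<le> v * (a x / x)" "v * (a x / x) \<le> 1"
      proof -
        show "0 \<le> v * (a x / x)" using v elim by simp
        have "v * (a x / x) \<le> (K + 1) * (1 / (K + 1))"
          using v elim by (intro mult_mono) auto
        then show "v * (a x / x) \<le> 1" using assms(2) by simp
      qed
      have habs: "\<bar>h\<bar> \<le> \<bar>t\<bar>"
        using vx mult_left_mono[of "v * (a x / x)" 1 "\<bar>t\<bar>"]
        unfolding h_def mult.assoc abs_mult[of t] abs_of_nonneg[OF vx(1)] by simp
      have hd: "\<bar>h\<bar> < d"
      proof -
        have "\<bar>h\<bar> = \<bar>t\<bar> * v * (a x / x)"
          using vx v elim(4,5) by (simp add: h_def abs_mult)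
        also have "\<dots> \<le> \<bar>t\<bar> * K * (a x / x)"
          using v elim by (intro mult_right_mono mult_left_mono) auto
        also have "\<dots> \<le> (\<bar>t\<bar> * K + 1) * (a x / x)"
          using elim by (intro mult_right_mono) auto
        also have "\<dots> < d"
          using elim(1) assms(2) Kt(1)
          by (metis (no_types, opaque_lifting) abs_ge_zero add_nonneg_pos less_divide_eq
              mult.commute mult_nonneg_nonneg zero_less_one)
        finally show ?thesis .
      qed
      define u where "u = v + t + h"
      have u: "\<bar>u\<bar> \<le> M"
        using v habs by (auto simp: u_def M_def abs_le_iff)
      have y': "(x + t * a x) / x * y = x + u * a x"
        using elim(5) by (simp add: v(3) u_def h_def field_simps power2_eq_square)
      have p: "\<bar>T (x + u * a x) / T x - exp (- u)\<bar> < \<delta>"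
        using elim(3) u by (auto simp: abs_le_iff)
      have q: "\<bar>T y / T x - exp (- v)\<bar> < \<delta>"
      proof -
        have "v \<in> {- M..M}" using v by (auto simp: M_def)
        then show ?thesis using elim(3) unfolding v(3) by blast
      qed
      have r: "\<bar>exp (- u) - exp (- t) * exp (- v)\<bar> \<le> exp \<bar>t\<bar> * \<delta>"
      proof -
        have "exp (- u) - exp (- t) * exp (- v) = exp (- t - v) * (exp (- h) - 1)"
          by (simp add: u_def algebra_simps flip: exp_add)
        then have "\<bar>exp (- u) - exp (- t) * exp (- v)\<bar> = exp (- t - v) * \<bar>exp (- h) - 1\<bar>"
          by (simp add: abs_mult)
        also have "\<dots> \<le> exp \<bar>t\<bar> * \<delta>"
          using d(2)[OF hd] v by (intro mult_mono) auto
        finally show ?thesis .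
      qed
      have et: "exp (- t) \<le> exp \<bar>t\<bar>" "1 \<le> exp \<bar>t\<bar>" by auto
      have "\<bar>T (x + u * a x) / T x - exp (- t) * (T y / T x)\<bar>
          \<le> \<bar>T (x + u * a x) / T x - exp (- u)\<bar> + \<bar>exp (- u) - exp (- t) * exp (- v)\<bar>
            + \<bar>exp (- t) * (exp (- v) - T y / T x)\<bar>"
        unfolding right_diff_distrib by linarith
      also have "\<bar>exp (- t) * (exp (- v) - T y / T x)\<bar> \<le> exp \<bar>t\<bar> * \<delta>"
        using q et(1) unfolding abs_mult by (intro mult_mono) auto
      finally have main: "\<bar>T (x + u * a x) / T x - exp (- t) * (T y / T x)\<bar> \<le> 3 * exp \<bar>t\<bar> * \<delta>"
        using p r et(2) \<delta> mult_right_mono[OF et(2), of \<delta>] by linarith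
      have Ty: "exp (- K) / 2 \<le> T y / T x"
      proof -
        have "exp (- K) \<le> exp (- v)" using v by simp
        then show ?thesis using q \<delta>_le by linarith
      qed
      have "3 * exp \<bar>t\<bar> * \<delta> = e' * (exp (- K) / 2)"
        by (simp add: \<delta>_def exp_diff exp_minus field_simps)
      also have "\<dots> \<le> e' * (T y / T x)"
        using Ty e' by (intro mult_left_mono) auto
      also have "\<dots> \<le> e * (T y / T x)"
        using e' T_pos[of x] T_pos[of y] by (intro mult_right_mono) auto
      finally have "\<bar>T (x + u * a x) / T x - exp (- t) * (T y / T x)\<bar> \<le> e * (T y / T x)"
        using main by linarith
      then have "\<bar>(T (x + u * a x) - exp (- t) * T y) / T x\<bar> \<le> e * T y / T x"
        by (simp add: diff_divide_distrib)
      then have "\<bar>T (x + u * a x) - exp (- t) * T y\<bar> \<le> e * T y"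
        using T_pos[of x] by (simp add: abs_divide divide_le_cancel)
      then show "\<bar>T ((x + t * a x) / x * y) - exp (- t) * T y\<bar> \<le> e * T y"
        unfolding y' .
    qed
  qed
qed

end

section \<open>Products with an independent factor bounded by one\<close>

text \<open>Only the tail \<open>T\<close> and the law of \<open>S\<close> enter. The variable
  \<open>R\<close> and its independence of \<open>S\<close> come in with
  \<open>prob_product_exceeds\<close>, which identifies \<open>product_tail\<close> with a
  probability.\<close>

locale gumbel_product = gumbel_tail a T + prob_space N
  for a T :: "real \<Rightarrow> real" and N :: "'n measure" +
  fixes S :: "'n \<Rightarrow> real"
  assumes S_measurable [measurable]: "S \<in> borel_measurable N"
    and S_pos: "\<omega> \<in> space N \<Longrightarrow> 0 < S \<omega>"
    and S_le_one: "\<omega> \<in> space N \<Longrightarrow> S \<omega> \<le> 1"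
    and S_near_one: "0 < \<tau> \<Longrightarrow> 0 < prob {\<omega>\<in>space N. 1 - \<tau> < S \<omega>}"
    and S_growth: "\<exists>l>1. \<forall>\<^sub>F \<tau> in at_right 0.
      prob {\<omega>\<in>space N. 1 - l * \<tau> < S \<omega>} \<le> 3 / 2 * prob {\<omega>\<in>space N. 1 - \<tau> < S \<omega>}"
begin

definition G :: "real \<Rightarrow> real" where
  "G \<tau> = prob {\<omega>\<in>space N. 1 - \<tau> < S \<omega>}"

definition product_tail :: "real \<Rightarrow> real" where
  "product_tail x = expectation (\<lambda>\<omega>. T (x / S \<omega>))"

text \<open>For \<open>R\<close> independent of \<open>S\<close> with tail \<open>T\<close>, this is
  the probability that \<open>R * S > x\<close> and \<open>x / S \<ge> c\<close>: the contribution
  of values of \<open>S\<close> too far below \<open>1\<close>.\<close>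

definition far_tail :: "real \<Rightarrow> real \<Rightarrow> real" where
  "far_tail c x = expectation (\<lambda>\<omega>. T (x / S \<omega>) * indicator {y. c \<le> y} (x / S \<omega>))"

lemma T_bounds: "0 \<le> T x" "norm (T x) \<le> 1"
  using T_pos[of x] T_le_one[of x] by auto

lemma integrable_T: "integrable N (\<lambda>\<omega>. T (x / S \<omega>))"
  by (rule integrable_const_bound[where B = 1]) (use T_bounds in \<open>auto simp del: real_norm_def\<close>)

lemma integrable_far: "integrable N (\<lambda>\<omega>. T (x / S \<omega>) * indicator {y. c \<le> y} (x / S \<omega>))"
  by (rule integrable_const_bound[where B = 1])
    (use T_bounds in \<open>auto simp: indicator_def\<close>)

lemma G_mono: "\<tau> \<le> \<tau>' \<Longrightarrow> G \<tau> \<le> G \<tau>'"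
  unfolding G_def by (intro finite_measure_mono) auto

lemma G_le_one: "G \<tau> \<le> 1"
  unfolding G_def by (rule prob_le_1)

lemma G_pos: "0 < \<tau> \<Longrightarrow> 0 < G \<tau>"
  unfolding G_def by (rule S_near_one)

lemma product_tail_nonneg: "0 \<le> product_tail x"
  unfolding product_tail_def by (intro integral_nonneg_AE AE_I2 T_bounds)

text \<open>The growth hypothesis holds only for small arguments. From \<open>d\<close> on it is
  replaced by \<open>G \<le> 1 \<le> B * G \<tau>\<close>, so \<open>B\<close> is paid once and not
  at every step.\<close>

lemma G_geometric_growth:
  obtains l B where "1 < l" "0 < B" "\<And>n \<tau>. 0 < \<tau> \<Longrightarrow> G (l ^ n * \<tau>) \<le> B * (3 / 2) ^ n * G \<tau>"
proof -
  obtain l where l: "1 < l" "\<forall>\<^sub>F \<tau> in at_right 0. G (l * \<tau>) \<le> 3 / 2 * G \<tau>"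
    using S_growth unfolding G_def by blast
  obtain d where d: "0 < d" "\<And>\<tau>. 0 < \<tau> \<Longrightarrow> \<tau> < d \<Longrightarrow> G (l * \<tau>) \<le> 3 / 2 * G \<tau>"
    using l(2) unfolding eventually_at_right_field by auto
  define B where "B = 1 / G d"
  have B: "0 < B" "1 \<le> B"
    using G_pos[OF d(1)] G_le_one[of d] by (auto simp: B_def)
  have "G (l ^ n * \<tau>) \<le> B * (3 / 2) ^ n * G \<tau>" if "0 < \<tau>" for n \<tau>
    using that
  proof (induction n arbitrary: \<tau>)
    case 0
    then show ?case using B(2) G_pos[OF 0] by simp
  next
    case (Suc n)
    show ?case
    proof (cases "\<tau> < d")
      case True
      have "G (l ^ Suc n * \<tau>) = G (l ^ n * (l * \<tau>))" by (simp add: mult_ac)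
      also have "\<dots> \<le> B * (3 / 2) ^ n * G (l * \<tau>)"
        using Suc.prems l(1) by (intro Suc.IH) auto
      also have "\<dots> \<le> B * (3 / 2) ^ n * (3 / 2 * G \<tau>)"
        using d(2)[OF Suc.prems True] B by (intro mult_left_mono) auto
      finally show ?thesis by simp
    next
      case False
      then have "1 \<le> B * G \<tau>"
        using G_mono[of d \<tau>] G_pos[OF d(1)] by (simp add: B_def)
      also have "\<dots> \<le> (3 / 2) ^ Suc n * (B * G \<tau>)"
      proof -
        have "1 * (B * G \<tau>) \<le> (3 / 2) ^ Suc n * (B * G \<tau>)"
          using B G_pos[OF Suc.prems] by (intro mult_right_mono one_le_power) auto
        then show ?thesis by simp
      qed
      finally show ?thesis using G_le_one[of "l ^ Suc n * \<tau>"] by (simp only: mult_ac)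
    qed
  qed
  with l(1) B(1) show ?thesis by (rule that)
qed

section \<open>Decay of the far part\<close>

lemma far_tail_antimono: "c \<le> c' \<Longrightarrow> far_tail c' x \<le> far_tail c x"
  unfolding far_tail_def
  by (intro integral_mono integrable_far) (auto simp: indicator_def T_bounds)

lemma far_tail_le: "far_tail c x \<le> T c"
proof -
  have "far_tail c x \<le> expectation (\<lambda>_. T c)"
    unfolding far_tail_def
    by (intro integral_mono integrable_far) (auto simp: indicator_def T_bounds intro: T_mono)
  then show ?thesis by (simp add: prob_space)
qed

text \<open>Where \<open>c \<le> x / S < c'\<close>, one has \<open>T (x / S) \<le> T c\<close> and
  \<open>S > x / c'\<close>, an event of probability \<open>G (1 - x / c')\<close>.\<close>

lemma far_tail_step:
  assumes "0 < c" "0 < c'"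
  shows "far_tail c x \<le> T c * G (1 - x / c') + far_tail c' x"
proof -
  have eq: "x / S \<omega> < c' \<longleftrightarrow> x / c' < S \<omega>" if "\<omega> \<in> space N" for \<omega>
    using S_pos[OF that] assms by (simp add: divide_less_eq mult.commute)
  have int: "integrable N (\<lambda>\<omega>. T c * indicator {\<omega>\<in>space N. x / c' < S \<omega>} \<omega>)"
    by (intro integrable_mult_right integrable_real_indicator) (auto simp: less_top[symmetric])
  have "far_tail c x \<le> expectation (\<lambda>\<omega>. T c * indicator {\<omega>\<in>space N. x / c' < S \<omega>} \<omega>
      + T (x / S \<omega>) * indicator {y. c' \<le> y} (x / S \<omega>))"
    unfolding far_tail_def
  proof (intro integral_mono integrable_far Bochner_Integration.integrable_add int)
    fix \<omega> assume w: "\<omega> \<in> space N"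
    show "T (x / S \<omega>) * indicator {y. c \<le> y} (x / S \<omega>)
      \<le> T c * indicator {\<omega>\<in>space N. x / c' < S \<omega>} \<omega> + T (x / S \<omega>) * indicator {y. c' \<le> y} (x / S \<omega>)"
      using eq[OF w] w T_bounds(1)[of c] T_bounds(1)[of "x / S \<omega>"] T_mono[of c "x / S \<omega>"]
      by (auto simp: indicator_def not_le)
  qed
  also have "\<dots> = T c * G (1 - x / c') + far_tail c' x"
    unfolding far_tail_def G_def
    by (subst Bochner_Integration.integral_add[OF int integrable_far]) simp
  finally show ?thesis .
qed

text \<open>On the event \<open>S > 1 - a x / x / 2\<close> the quotient \<open>x / S\<close> is at
  most \<open>x + a x\<close>. This rests on \<open>1 / (1 + r) \<le> 1 - r / 2\<close> for
  \<open>0 \<le> r \<le> 1\<close>, applied to \<open>r = a x / x\<close>.\<close>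

lemma product_tail_lower:
  assumes "0 < x" "0 < a x" "a x \<le> x"
  shows "T (x + a x) * G (a x / x / 2) \<le> product_tail x"
proof -
  have "T (x + a x) * G (a x / x / 2)
      = expectation (\<lambda>\<omega>. T (x + a x) * indicator {\<omega>\<in>space N. 1 - a x / x / 2 < S \<omega>} \<omega>)"
    unfolding G_def by simp
  also have "\<dots> \<le> product_tail x"
    unfolding product_tail_def
  proof (intro integral_mono integrable_T)
    show "integrable N (\<lambda>\<omega>. T (x + a x) * indicator {\<omega>\<in>space N. 1 - a x / x / 2 < S \<omega>} \<omega>)"
      by (intro integrable_mult_right integrable_real_indicator) (auto simp: less_top[symmetric])
    fix \<omega> assume w: "\<omega> \<in> space N"
    have "x / S \<omega> \<le> x + a x" if "1 - a x / x / 2 < S \<omega>"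
    proof -
      have "x / (x + a x) \<le> 1 - a x / x / 2"
        using assms mult_right_mono[of "a x" x "a x"]
        by (simp add: divide_le_eq) (simp add: field_simps)
      with that have "x / (x + a x) \<le> S \<omega>" by linarith
      then show ?thesis using S_pos[OF w] assms by (simp add: field_simps)
    qed
    then show "T (x + a x) * indicator {\<omega>\<in>space N. 1 - a x / x / 2 < S \<omega>} \<omega> \<le> T (x / S \<omega>)"
      using T_bounds(1)[of "x / S \<omega>"] by (auto simp: indicator_def intro: T_mono)
  qed
  finally show ?thesis .
qed

text \<open>Cut the event at the iterates of \<open>u \<mapsto> u + a u\<close> started in \<open>x\<close>. Along them \<open>T\<close> at least halves, while
  self-neglect of \<open>a\<close> lets their distance to \<open>x\<close>, and hence the argument of \<open>G\<close>, grow by a factor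
  close to \<open>1\<close>, so that \<open>G\<close> grows by at most \<open>3 / 2\<close>. The blocks thus decay like \<open>(3 / 4) ^ n\<close>.\<close>

lemma far_tail_geometric:
  obtains l C where "1 < l" "0 < C"
    "\<forall>\<^sub>F x in at_top. \<forall>n. far_tail (x + l ^ n / (l - 1) * a x) x \<le> C * (3 / 4) ^ n * product_tail x"
proof -
  obtain l B where lB: "1 < l" "0 < B"
    "\<And>n \<tau>. 0 < \<tau> \<Longrightarrow> G (l ^ n * \<tau>) \<le> B * (3 / 2) ^ n * G \<tau>"
    using G_geometric_growth by blast
  \<comment> \<open>\<open>l ^ k\<close> absorbs \<open>2 * l / (l - 1)\<close>: the geometric sum
    of step lengths contributes \<open>l / (l - 1)\<close>, and the \<open>2\<close> comes from the
    argument \<open>a x / x / 2\<close> in \<open>product_tail_lower\<close>. The price is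
    \<open>(3 / 2) ^ k\<close> in \<open>C\<close>; the \<open>4\<close> there undoes
    \<open>1 / 4 * T x \<le> T (x + a x)\<close>.\<close>
  obtain k where k: "2 * l / (l - 1) < l ^ k"
    using real_arch_pow[OF lB(1)] by blast
  define C where "C = 4 * B * (3 / 2) ^ k"
  have C: "0 < C" using lB by (simp add: C_def)
  \<comment> \<open>The upper bound drives the decay along the iterates; the lower bound leads from
    \<open>T (x + a x)\<close> in \<open>product_tail_lower\<close> back to
    \<open>T x\<close>.\<close>
  have e1: "exp (- 1) < (1 / 2 :: real)" "1 / 4 < exp (- 1 :: real)"
  proof -
    have "inverse (2 ^ 32) \<le> (1 / 2 :: real)" by simp
    with e_approx_32 have "\<bar>exp 1 - 5837465777 / 2147483648\<bar> \<le> (1 / 2 :: real)"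
      by (rule order_trans)
    then have "2 < exp (1::real)" "exp (1::real) < 4"
      unfolding abs_le_iff by (linarith, linarith)
    then show "exp (- 1) < (1 / 2 :: real)" "1 / 4 < exp (- 1 :: real)"
      by (auto simp: exp_minus field_simps)
  qed
  have "\<forall>\<^sub>F x in at_top. T (x + a x) / T x < 1 / 2" "\<forall>\<^sub>F x in at_top. 1 / 4 < T (x + a x) / T x"
    using order_tendstoD(2)[OF T_ratio e1(1)] order_tendstoD(1)[OF T_ratio e1(2)]
    by (simp_all only: mult_1)
  moreover have "\<forall>\<^sub>F x in at_top. a (x + a x) / a x < l"
    using scale_self_neglecting[of 1] lB(1) by (auto intro: order_tendstoD)
  ultimately have "\<forall>\<^sub>F x in at_top. 0 < a x \<and> a x \<le> 1 * x \<and> 0 < x \<and>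
      a (x + a x) \<le> l * a x \<and> T (x + a x) \<le> 1 / 2 * T x \<and> 1 / 4 * T x \<le> T (x + a x)"
    using scale_pos scale_sublinear[OF zero_less_one] eventually_gt_at_top[of 0]
  proof eventually_elim
    case (elim x)
    then show ?case using T_pos[of x] by (simp add: divide_less_eq less_divide_eq)
  qed
  \<comment> \<open>The iterates only move to the right, so estimates valid beyond a single
    \<open>x0\<close> apply at each of them. This makes the final bound uniform in \<open>x\<close>
    and \<open>n\<close>.\<close>
  then obtain x0 where x0: "\<And>x. x0 \<le> x \<Longrightarrow> 0 < a x" "\<And>x. x0 \<le> x \<Longrightarrow> a x \<le> x"
    "\<And>x. x0 \<le> x \<Longrightarrow> 0 < x" "\<And>x. x0 \<le> x \<Longrightarrow> a (x + a x) \<le> l * a x"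
    "\<And>x. x0 \<le> x \<Longrightarrow> T (x + a x) \<le> 1 / 2 * T x" "\<And>x. x0 \<le> x \<Longrightarrow> 1 / 4 * T x \<le> T (x + a x)"
    unfolding eventually_at_top_linorder by auto
  have "far_tail (x + l ^ n / (l - 1) * a x) x \<le> 4 * C * (3 / 4) ^ n * product_tail x"
    if x: "x0 \<le> x" for x n
  proof -
    define y where "y n = ((\<lambda>u. u + a u) ^^ n) x" for n
    have y_Suc: "y (Suc n) = y n + a (y n)" for n
      by (simp add: y_def)
    have y_bounds: "x \<le> y n \<and> a (y n) \<le> l ^ n * a x \<and> T (y n) \<le> (1 / 2) ^ n * T x
        \<and> y n \<le> x + (l ^ n - 1) / (l - 1) * a x" for n
    proof (induction n)
      case 0
      show ?case by (simp add: y_def)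
    next
      case (Suc n)
      have yn: "x0 \<le> y n" using Suc x by linarith
      have "a (y (Suc n)) \<le> l * (l ^ n * a x)"
        unfolding y_Suc using Suc lB(1) x0(4)[OF yn]
        by (meson less_eq_real_def mult_left_mono order_trans zero_less_one)
      moreover have "T (y (Suc n)) \<le> 1 / 2 * ((1 / 2) ^ n * T x)"
        unfolding y_Suc using Suc x0(5)[OF yn] by linarith
      moreover have "y (Suc n) \<le> x + (l ^ n - 1) / (l - 1) * a x + l ^ n * a x"
        unfolding y_Suc using Suc by linarith
      moreover have "(l ^ n - 1) / (l - 1) * a x + l ^ n * a x = (l ^ Suc n - 1) / (l - 1) * a x"
        using lB(1) by (simp add: field_simps)
      ultimately show ?case
        using Suc x0(1)[OF yn] unfolding y_Suc[of n] by simp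
    qed
    define g where "g = G (a x / x / 2)"
    have x_pos: "0 < x" "0 < a x" using x0 x by auto
    have lower: "T x * g \<le> 4 * product_tail x"
    proof -
      have "1 / 4 * T x * g \<le> T (x + a x) * g"
        using x0(6)[OF x] G_pos[of "a x / x / 2"] x_pos
        by (intro mult_right_mono) (auto simp: g_def)
      also have "\<dots> \<le> product_tail x"
        unfolding g_def using x x0 by (intro product_tail_lower)
      finally show ?thesis by simp
    qed
    have block: "far_tail (y n) x \<le> C * (3 / 4) ^ n * product_tail x + far_tail (y (Suc n)) x" for n
    proof -
      have yp: "0 < y n" "0 < y (Suc n)" "x \<le> y (Suc n)"
        using y_bounds[of n] y_bounds[of "Suc n"] x_pos by auto
      have "1 - x / y (Suc n) = (y (Suc n) - x) / y (Suc n)"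
        using yp by (simp add: field_simps)
      also have "\<dots> \<le> (y (Suc n) - x) / x"
        using yp x_pos by (intro divide_left_mono) auto
      also have "\<dots> \<le> (l ^ Suc n - 1) / (l - 1) * a x / x"
        using y_bounds[of "Suc n"] x_pos by (intro divide_right_mono) auto
      also have "\<dots> \<le> l ^ Suc n / (l - 1) * a x / x"
        using lB(1) x_pos by (intro divide_right_mono mult_right_mono) auto
      also have "\<dots> = l ^ n * (2 * l / (l - 1)) * (a x / x / 2)"
        by simp
      also have "\<dots> \<le> l ^ n * l ^ k * (a x / x / 2)"
        using k lB(1) x_pos by (intro mult_right_mono mult_left_mono) auto
      also have "\<dots> = l ^ (n + k) * (a x / x / 2)" by (simp add: power_add)
      finally have "G (1 - x / y (Suc n)) \<le> G (l ^ (n + k) * (a x / x / 2))" by (rule G_mono)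
      also have "\<dots> \<le> B * (3 / 2) ^ (n + k) * g"
        unfolding g_def using x_pos by (intro lB(3)) simp
      finally have "T (y n) * G (1 - x / y (Suc n))
          \<le> ((1 / 2) ^ n * T x) * (B * (3 / 2) ^ (n + k) * g)"
        using y_bounds[of n] T_pos[of x] by (intro mult_mono) (auto simp: G_def)
      also have "\<dots> = B * (3 / 2) ^ k * (3 / 4) ^ n * (T x * g)"
      proof -
        have "(1 / 2) ^ n * (3 / 2) ^ n = ((3 / 4) ^ n :: real)"
          by (simp add: power_mult_distrib[symmetric])
        then show ?thesis by (simp add: power_add mult_ac)
      qed
      also have "\<dots> \<le> B * (3 / 2) ^ k * (3 / 4) ^ n * (4 * product_tail x)"
        using lower lB by (intro mult_left_mono) auto
      also have "\<dots> = C * (3 / 4) ^ n * product_tail x"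
        by (simp add: C_def)
      finally show ?thesis
        using far_tail_step[OF yp(1,2), of x] by linarith
    qed
    \<comment> \<open>The blocks from \<open>n\<close> to \<open>n + m - 1\<close> form a partial
      geometric series with ratio \<open>3 / 4\<close>, whence the factor \<open>4\<close>. What
      remains beyond \<open>y (n + m)\<close> is at most \<open>(1 / 2) ^ (n + m) * T x\<close> and
      disappears as \<open>m\<close> grows.\<close>
    have "far_tail (y n) x \<le> 4 * C * product_tail x * ((3 / 4) ^ n - (3 / 4) ^ (n + m))
        + far_tail (y (n + m)) x" for m
    proof (induction m)
      case 0
      show ?case by simp
    next
      case (Suc m)
      have "4 * C * product_tail x * ((3 / 4) ^ n - (3 / 4) ^ (n + Suc m))
        = 4 * C * product_tail x * ((3 / 4) ^ n - (3 / 4) ^ (n + m))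
          + C * (3 / 4) ^ (n + m) * product_tail x"
        by (simp add: algebra_simps)
      then show ?case using Suc block[of "n + m"] by simp
    qed
    moreover have "far_tail (y (n + m)) x \<le> (1 / 2) ^ (n + m) * T x" for m
      using far_tail_le[of "y (n + m)" x] y_bounds[of "n + m"] by linarith
    ultimately have bound: "far_tail (y n) x \<le> 4 * C * product_tail x * ((3 / 4) ^ n - (3 / 4) ^ (n + m))
        + (1 / 2) ^ (n + m) * T x" for m
      by (meson add_left_mono order_trans)
    have "(\<lambda>m. 4 * C * product_tail x * ((3 / 4) ^ n - (3 / 4) ^ (n + m)) + (1 / 2) ^ (n + m) * T x)
        \<longlonglongrightarrow> 4 * C * product_tail x * ((3 / 4) ^ n - (3 / 4) ^ n * 0) + (1 / 2) ^ n * 0 * T x"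
      unfolding power_add by (intro tendsto_intros LIMSEQ_realpow_zero) auto
    then have "far_tail (y n) x \<le> 4 * C * product_tail x * ((3 / 4) ^ n - (3 / 4) ^ n * 0) + (1 / 2) ^ n * 0 * T x"
      by (rule LIMSEQ_le_const) (use bound in blast)
    moreover have "y n \<le> x + l ^ n / (l - 1) * a x"
    proof -
      have "(l ^ n - 1) / (l - 1) * a x \<le> l ^ n / (l - 1) * a x"
        using lB(1) x_pos by (intro mult_right_mono divide_right_mono) auto
      then show ?thesis using y_bounds[of n] by linarith
    qed
    ultimately show ?thesis
      using far_tail_antimono[of "y n" "x + l ^ n / (l - 1) * a x" x] by (simp add: mult_ac)
  qed
  then have "\<forall>\<^sub>F x in at_top. \<forall>n.
      far_tail (x + l ^ n / (l - 1) * a x) x \<le> 4 * C * (3 / 4) ^ n * product_tail x"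
    unfolding eventually_at_top_linorder by blast
  then show ?thesis using that[of l "4 * C"] lB(1) C by simp
qed

lemma far_tail_negligible:
  assumes "0 < e"
  obtains K where "0 < K" "\<forall>\<^sub>F x in at_top. far_tail (x + K * a x) x \<le> e * product_tail x"
proof -
  obtain l C where lC: "1 < l" "0 < C"
    "\<forall>\<^sub>F x in at_top. \<forall>n. far_tail (x + l ^ n / (l - 1) * a x) x \<le> C * (3 / 4) ^ n * product_tail x"
    by (rule far_tail_geometric)
  obtain n where n: "(3 / 4) ^ n < e / C"
    using real_arch_pow_inv[of "e / C" "3 / 4"] assms lC(2) by auto
  have "\<forall>\<^sub>F x in at_top. far_tail (x + l ^ n / (l - 1) * a x) x \<le> e * product_tail x"
    using lC(3)
  proof eventually_elim
    case (elim x)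
    have "C * (3 / 4) ^ n * product_tail x \<le> e * product_tail x"
      using n lC(2) by (intro mult_right_mono product_tail_nonneg) (simp add: field_simps)
    then show ?case using elim[rule_format, of n] by linarith
  qed
  then show ?thesis using that[of "l ^ n / (l - 1)"] lC(1) by simp
qed

section \<open>The product tail is again of Gumbel type\<close>

lemma product_tail_pos: "0 < product_tail x"
proof -
  have "\<not> (AE \<omega> in N. T (x / S \<omega>) = 0)"
    using T_pos by (auto simp: less_imp_neq[THEN not_sym] AE_False emeasure_space_1)
  moreover have "product_tail x = 0 \<longleftrightarrow> (AE \<omega> in N. T (x / S \<omega>) = 0)"
    unfolding product_tail_def by (intro integral_nonneg_eq_0_iff_AE integrable_T AE_I2 T_bounds)
  ultimately show ?thesis using product_tail_nonneg[of x] by linarith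
qed

lemma product_tail_antimono: "x \<le> y \<Longrightarrow> product_tail y \<le> product_tail x"
  unfolding product_tail_def
  by (intro integral_mono integrable_T T_mono divide_right_mono) (auto intro: less_imp_le S_pos)

lemma product_tail_le:
  assumes "0 \<le> x"
  shows "product_tail x \<le> T x"
proof -
  have "product_tail x \<le> expectation (\<lambda>_. T x)"
    unfolding product_tail_def
  proof (intro integral_mono integrable_T T_mono)
    fix \<omega> assume "\<omega> \<in> space N"
    then show "x \<le> x / S \<omega>"
      using S_pos[of \<omega>] S_le_one[of \<omega>] assms mult_left_mono[of "S \<omega>" 1 x]
      by (simp add: le_divide_eq)
  qed simp
  then show ?thesis by (simp add: prob_space)
qed

lemma product_tail_lower_scaled:
  assumes "0 \<le> x" "0 < m" "m < 1"
  shows "T (x / m) * G (1 - m) \<le> product_tail x"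
proof -
  have "T (x / m) * G (1 - m) = expectation (\<lambda>\<omega>. T (x / m) * indicator {\<omega>\<in>space N. m < S \<omega>} \<omega>)"
    unfolding G_def by simp
  also have "\<dots> \<le> product_tail x"
    unfolding product_tail_def
  proof (intro integral_mono integrable_T)
    show "integrable N (\<lambda>\<omega>. T (x / m) * indicator {\<omega>\<in>space N. m < S \<omega>} \<omega>)"
      by (intro integrable_mult_right integrable_real_indicator) (auto simp: less_top[symmetric])
    fix \<omega> assume w: "\<omega> \<in> space N"
    have "x / S \<omega> \<le> x / m" if "m < S \<omega>"
      using that assms S_pos[OF w] by (intro divide_left_mono) auto
    then show "T (x / m) * indicator {\<omega>\<in>space N. m < S \<omega>} \<omega> \<le> T (x / S \<omega>)"
      using T_bounds(1)[of "x / S \<omega>"] by (auto simp: indicator_def intro: T_mono)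
  qed
  finally show ?thesis .
qed

text \<open>For \<open>1 < p < q\<close> the event \<open>S > 1 / p\<close> has positive
  probability, so \<open>product_tail x\<close> is at least a constant times
  \<open>T (p * x)\<close>. Rapid variation makes \<open>T (q * x)\<close> negligible against
  that.\<close>

lemma T_scaled_over_product_tail:
  assumes "1 < q"
  shows "((\<lambda>x. T (q * x) / product_tail x) \<longlongrightarrow> 0) at_top"
proof -
  obtain p where p: "1 < p" "p < q" using assms dense by blast
  define c where "c = G (1 - 1 / p)"
  have c: "0 < c" unfolding c_def using p by (intro G_pos) simp
  have lim: "((\<lambda>x. T (q / p * (p * x)) / T (p * x) / c) \<longlongrightarrow> 0 / c) at_top"
    using p c
    by (intro tendsto_divide filterlim_compose[OF T_rapidly_varying[of "q / p"]] tendsto_const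
        filterlim_tendsto_pos_mult_at_top[OF tendsto_const _ filterlim_ident]) auto
  show ?thesis
  proof (rule tendsto_sandwich)
    show "\<forall>\<^sub>F x in at_top. 0 \<le> T (q * x) / product_tail x"
      using T_pos product_tail_pos by (auto intro!: always_eventually divide_nonneg_pos less_imp_le)
    show "((\<lambda>x. T (q / p * (p * x)) / T (p * x) / c) \<longlongrightarrow> 0) at_top" using lim by simp
    show "\<forall>\<^sub>F x in at_top. T (q * x) / product_tail x \<le> T (q / p * (p * x)) / T (p * x) / c"
      using eventually_ge_at_top[of 0]
    proof eventually_elim
      case (elim x)
      have "T (p * x) * c \<le> product_tail x"
        using product_tail_lower_scaled[of x "1 / p"] elim p by (simp add: c_def mult.commute)
      then have "T (q * x) / product_tail x \<le> T (q * x) / (T (p * x) * c)"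
        using T_pos c product_tail_pos by (intro divide_left_mono) (auto simp: less_imp_le)
      then show ?case using p by simp
    qed
  qed (rule tendsto_const)
qed

lemma product_tail_ratio: "((\<lambda>x. product_tail (x + t * a x) / product_tail x) \<longlongrightarrow> exp (- t)) at_top"
proof (rule tendstoI)
  fix e0 :: real assume "0 < e0"
  define L where "L = exp (- t)"
  have L: "0 < L" by (simp add: L_def)
  \<comment> \<open>The estimate will contain its own unknown: for
    \<open>r = product_tail x' / product_tail x\<close> it reads
    \<open>\<bar>r - L\<bar> \<le> e * (1 + r + L)\<close>. The cap \<open>e \<le> 1 / 2\<close>
    gives \<open>r \<le> 1 + 3 * L\<close>, and then \<open>e * (3 + 5 * L) < e0\<close>
    concludes.\<close>
  define e where "e = min (1 / 2) (e0 / (2 * (3 + 5 * L)))"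
  have e: "0 < e" "e \<le> 1 / 2" "e * (3 + 5 * L) < e0"
  proof -
    show "0 < e" "e \<le> 1 / 2" using \<open>0 < e0\<close> L unfolding e_def by (simp, linarith)
    have "e * (3 + 5 * L) \<le> e0 / (2 * (3 + 5 * L)) * (3 + 5 * L)"
      using L by (intro mult_right_mono) (auto simp: e_def)
    also have "\<dots> = e0 / 2" using L by (simp add: field_simps)
    finally show "e * (3 + 5 * L) < e0" using \<open>0 < e0\<close> by linarith
  qed
  obtain K where K: "0 < K" "\<forall>\<^sub>F x in at_top. far_tail (x + K * a x) x \<le> e * product_tail x"
    using far_tail_negligible[OF e(1)] by blast
  have "\<forall>\<^sub>F x in at_top. far_tail ((x + t * a x) + K * a (x + t * a x)) (x + t * a x)
      \<le> e * product_tail (x + t * a x)"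
    using filterlim_shift[of t] K(2) by (rule eventually_compose_filterlim[rotated])
  moreover have "\<forall>\<^sub>F x in at_top. a (x + t * a x) / a x < 2"
    using scale_self_neglecting[of t] by (rule order_tendstoD) simp
  moreover have "\<forall>\<^sub>F x in at_top. - (1 / 2) < t * (a x / x)"
    using tendsto_mult[OF tendsto_const[of t] scale_over_arg_tendsto] by (rule order_tendstoD) simp
  \<comment> \<open>\<open>x' / x > 1 / 2\<close> and \<open>a x' \<le> 2 * a x\<close> cost a
    factor \<open>2\<close> each. With \<open>4 * K\<close>, an \<open>x / S\<close> beyond the cut
    for \<open>x\<close> forces \<open>x' / S\<close> beyond the cut \<open>x' + K * a x'\<close>
    for \<open>x'\<close>.\<close>
  moreover have "\<forall>\<^sub>F x in at_top. \<forall>y\<in>{x..x + (4 * K) * a x}.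
           \<bar>T ((x + t * a x) / x * y) - exp (- t) * T y\<bar> \<le> e * T y"
    using K(1) by (intro T_ratio_rescaled_uniform e) simp
  ultimately show "\<forall>\<^sub>F x in at_top. dist (product_tail (x + t * a x) / product_tail x) (exp (- t)) < e0"
    using K(2) scale_pos eventually_gt_at_top[of 0]
  proof eventually_elim
    case (elim x)
    define x' where "x' = x + t * a x"
    define D where "D = {y. x + 4 * K * a x \<le> y}"
    define D' where "D' = {y. x' + K * a x' \<le> y}"
    have x': "1 / 2 < x' / x" "x' / x * x = x'"
      using elim(3,7) by (simp_all add: x'_def field_simps)
    have ax': "a x' \<le> 2 * a x"
      using elim(2,6) by (simp add: x'_def divide_less_eq)
    \<comment> \<open>Points near the cut level are charged to the relative error, far ones to the
      two indicator terms.\<close>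
    have pw: "\<bar>T (x' / S \<omega>) - L * T (x / S \<omega>)\<bar>
      \<le> e * T (x / S \<omega>) + T (x' / S \<omega>) * indicator D' (x' / S \<omega>)
          + L * (T (x / S \<omega>) * indicator D (x / S \<omega>))" if w: "\<omega> \<in> space N" for \<omega>
    proof -
      define y where "y = x / S \<omega>"
      have y: "x \<le> y" "x' / S \<omega> = x' / x * y"
        using S_pos[OF w] S_le_one[OF w] elim(7) mult_left_mono[of "S \<omega>" 1 x]
        by (auto simp: y_def le_divide_eq)
      have nn: "0 \<le> T (x' / S \<omega>)" "0 \<le> T y" using T_bounds by auto
      show ?thesis
      proof (cases "x + 4 * K * a x \<le> y")
        case True
        have "x' + K * a x' \<le> x' + K * (2 * a x)"
          using ax' K(1) by simp
        also have "\<dots> \<le> x' + (x' / x) * (4 * K * a x)"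
          using mult_right_mono[of "1/2" "x' / x" "4 * K * a x"] x' K(1) elim(6) by simp
        also have "\<dots> = x' / x * (x + 4 * K * a x)"
          unfolding distrib_left x'(2) ..
        also have "\<dots> \<le> x' / x * y"
          using True x'(1) by (intro mult_left_mono order.trans[OF _ less_imp_le[OF x'(1)]]) simp_all
        finally have D: "indicator D' (x' / S \<omega>) = (1::real)" "indicator D y = (1::real)"
          using True y(2) by (auto simp: D'_def D_def)
        have "\<bar>T (x' / S \<omega>) - L * T y\<bar> \<le> T (x' / S \<omega>) + L * T y"
          using nn L by (simp add: abs_le_iff)
        then show ?thesis
          unfolding y_def[symmetric] D using mult_nonneg_nonneg[of e "T y"] nn e(1) by linarith
      next
        case False
        have "\<bar>T (x' / S \<omega>) - L * T y\<bar> \<le> e * T y"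
          unfolding y(2) unfolding L_def x'_def by (rule elim(4)[rule_format]) (use y(1) False in auto)
        moreover have "0 \<le> T (x' / S \<omega>) * indicator D' (x' / S \<omega>)" "0 \<le> L * (T y * indicator D y)"
          using nn L by auto
        ultimately show ?thesis
          unfolding y_def[symmetric] by linarith
      qed
    qed
    have "\<bar>product_tail x' - L * product_tail x\<bar>
       = \<bar>expectation (\<lambda>\<omega>. T (x' / S \<omega>) - L * T (x / S \<omega>))\<bar>"
      unfolding product_tail_def using integrable_T by simp
    also have "\<dots> \<le> expectation (\<lambda>\<omega>. \<bar>T (x' / S \<omega>) - L * T (x / S \<omega>)\<bar>)"
      by (rule integral_abs_bound)
    also have "\<dots> \<le> expectation (\<lambda>\<omega>. e * T (x / S \<omega>) + T (x' / S \<omega>) * indicator D' (x' / S \<omega>)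
          + L * (T (x / S \<omega>) * indicator D (x / S \<omega>)))"
      unfolding D_def D'_def
      by (intro integral_mono pw[unfolded D_def D'_def] integrable_abs
          Bochner_Integration.integrable_diff Bochner_Integration.integrable_add integrable_mult_right integrable_T integrable_far)
    also have "\<dots> = e * product_tail x + far_tail (x' + K * a x') x' + L * far_tail (x + 4 * K * a x) x"
      unfolding D_def D'_def product_tail_def far_tail_def
      using integrable_T integrable_far by simp
    also have "far_tail (x + 4 * K * a x) x \<le> e * product_tail x"
      using elim(5) far_tail_antimono[of "x + K * a x" "x + 4 * K * a x" x] K(1) elim(6) by simp
    also have "far_tail (x' + K * a x') x' \<le> e * product_tail x'"
      using elim(1) by (simp add: x'_def)
    finally have "\<bar>product_tail x' - L * product_tail x\<bar>
        \<le> e * product_tail x + e * product_tail x' + L * (e * product_tail x)"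
      using L by simp
    then have "\<bar>product_tail x' - L * product_tail x\<bar> / product_tail x
        \<le> (e * product_tail x + e * product_tail x' + L * (e * product_tail x)) / product_tail x"
      using product_tail_pos[of x] by (intro divide_right_mono) auto
    moreover define r where "r = product_tail x' / product_tail x"
    moreover have "\<bar>product_tail x' - L * product_tail x\<bar> / product_tail x = \<bar>r - L\<bar>"
    proof -
      have "r - L = (product_tail x' - L * product_tail x) / product_tail x"
        using product_tail_pos[of x] unfolding r_def by (simp add: diff_divide_distrib)
      then show ?thesis using product_tail_pos[of x] by simp
    qed
    moreover have "(e * product_tail x + e * product_tail x' + L * (e * product_tail x)) / product_tail x
        = e * (1 + r + L)"
      using product_tail_pos[of x] unfolding r_def by (simp add: field_simps)
    ultimately have r: "\<bar>r - L\<bar> \<le> e * (1 + r + L)" by simp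
    have "0 \<le> r" using product_tail_nonneg by (simp add: r_def)
    then have "e * (1 + r + L) \<le> 1 / 2 * (1 + r + L)"
      using e L by (intro mult_right_mono) auto
    then have "r \<le> 1 + 3 * L" using r by (simp add: abs_le_iff)
    then have "e * (1 + r + L) \<le> e * (3 + 5 * L)"
      using e L by (intro mult_left_mono) auto
    then show ?case
      using r e(3) by (simp add: r_def x'_def L_def dist_real_def)
  qed
qed

lemma gumbel_tail_product: "gumbel_tail a product_tail"
proof
  show "antimono product_tail" by (intro antimonoI product_tail_antimono)
  show "0 < product_tail x" for x by (rule product_tail_pos)
  show "product_tail x \<le> 1" for x
    unfolding product_tail_def by (rule integral_le_const[OF integrable_T]) (auto simp: T_le_one)
  show "(product_tail \<longlongrightarrow> 0) at_top"
  proof (rule tendsto_sandwich[OF _ _ tendsto_const T_vanish])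
    show "\<forall>\<^sub>F x in at_top. 0 \<le> product_tail x" by (simp add: product_tail_nonneg)
    show "\<forall>\<^sub>F x in at_top. product_tail x \<le> T x"
      using eventually_ge_at_top[of 0] by eventually_elim (rule product_tail_le)
  qed
qed (rule scale_pos product_tail_ratio)+

end

text \<open>Both marginal tails dominate a multiple of a product tail, so this form serves
  \<open>U\<close> and \<open>V\<close> alike.\<close>

lemma (in gumbel_product) T_scaled_over_dominating:
  assumes "1 < q" "0 < p" and B: "\<And>x. 0 \<le> x \<Longrightarrow> p * product_tail x \<le> B x"
  shows "((\<lambda>x. T (q * x) / B x) \<longlongrightarrow> 0) at_top"
proof (rule tendsto_sandwich[OF _ _ tendsto_const])
  show "((\<lambda>x. T (q * x) / product_tail x / p) \<longlongrightarrow> 0) at_top"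
    using tendsto_divide[OF T_scaled_over_product_tail[OF \<open>1 < q\<close>] tendsto_const[of p]] \<open>0 < p\<close> by simp
  have B_pos: "0 < B x" if "0 \<le> x" for x
    using B[OF that] product_tail_pos[of x] \<open>0 < p\<close> mult_pos_pos[of p "product_tail x"] by linarith
  show "\<forall>\<^sub>F x in at_top. 0 \<le> T (q * x) / B x"
    using eventually_ge_at_top[of 0]
    by eventually_elim (intro divide_nonneg_pos T_bounds B_pos)
  show "\<forall>\<^sub>F x in at_top. T (q * x) / B x \<le> T (q * x) / product_tail x / p"
    using eventually_ge_at_top[of 0]
  proof eventually_elim
    case (elim x)
    have "T (q * x) / B x \<le> T (q * x) / (p * product_tail x)"
      using B[OF elim] B_pos[OF elim] product_tail_pos[of x] \<open>0 < p\<close> T_bounds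
      by (intro divide_left_mono) auto
    then show ?case by (simp add: mult.commute)
  qed
qed

section \<open>Distribution functions and quantiles\<close>

lemma (in prob_space) distr_fun_eq_prob:
  assumes [measurable]: "Z \<in> borel_measurable M"
  shows "distr_fun M Z x = \<P>(\<omega> in M. Z \<omega> \<le> x)"
  unfolding distr_fun_def cdf_def
  by (subst measure_distr) (auto intro!: arg_cong[where f = prob])

lemma (in prob_space) tail_eq_prob:
  assumes [measurable]: "Z \<in> borel_measurable M"
  shows "1 - distr_fun M Z x = \<P>(\<omega> in M. x < Z \<omega>)"
proof -
  have "\<P>(\<omega> in M. x < Z \<omega>) = prob (space M - {\<omega>\<in>space M. Z \<omega> \<le> x})"
    by (auto intro!: arg_cong[where f = prob])
  also have "\<dots> = 1 - distr_fun M Z x"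
    by (subst prob_compl) (auto simp: distr_fun_eq_prob)
  finally show ?thesis ..
qed

lemma (in prob_space) distr_fun_measurable:
  assumes [measurable]: "Z \<in> borel_measurable M"
  shows "distr_fun M Z \<in> borel_measurable borel"
proof (rule borel_measurable_mono)
  interpret D: real_distribution "distr M borel Z"
    by (rule real_distribution_distr) simp
  show "mono (distr_fun M Z)"
    unfolding distr_fun_def by (intro monoI D.cdf_nondecreasing)
qed

text \<open>A zero of the tail at \<open>x\<close> would bound the upper endpoint by
  \<open>x\<close>; conversely, a tail positive everywhere makes the set in
  \<open>upper_endpoint\<close> the whole line.\<close>

lemma (in prob_space) gumbel_mda_iff_gumbel_tail:
  assumes [measurable]: "Z \<in> borel_measurable M"
  shows "gumbel_mda w (distr_fun M Z) \<longleftrightarrow> gumbel_tail (\<lambda>x. 1 / w x) (\<lambda>x. 1 - distr_fun M Z x)"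
proof -
  interpret D: real_distribution "distr M borel Z"
    by (rule real_distribution_distr) simp
  have mono: "x \<le> y \<Longrightarrow> distr_fun M Z x \<le> distr_fun M Z y" for x y
    unfolding distr_fun_def by (rule D.cdf_nondecreasing)
  show ?thesis
  proof
    assume mda: "gumbel_mda w (distr_fun M Z)"
    show "gumbel_tail (\<lambda>x. 1 / w x) (\<lambda>x. 1 - distr_fun M Z x)"
    proof
      show "antimono (\<lambda>x. 1 - distr_fun M Z x)" by (intro antimonoI) (auto intro: mono)
      show "1 - distr_fun M Z x \<le> 1" for x
        by (simp add: distr_fun_eq_prob)
      show "0 < 1 - distr_fun M Z x" for x
      proof (rule ccontr)
        assume "\<not> 0 < 1 - distr_fun M Z x"
        then have "y \<le> x" if "distr_fun M Z y < 1" for y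
          using mono[of x y] that by linarith
        then have "upper_endpoint (distr_fun M Z) \<le> ereal x"
          unfolding upper_endpoint_def by (intro SUP_least) auto
        then show False using mda by (simp add: gumbel_mda_def)
      qed
      show "((\<lambda>x. 1 - distr_fun M Z x) \<longlongrightarrow> 0) at_top"
        using tendsto_diff[OF tendsto_const[of 1] D.cdf_lim_at_top_prob] by (simp add: distr_fun_def)
      show "\<forall>\<^sub>F x in at_top. 0 < 1 / w x"
        using mda by (simp add: gumbel_mda_def)
      show "((\<lambda>x. (1 - distr_fun M Z (x + t * (1 / w x))) / (1 - distr_fun M Z x)) \<longlongrightarrow> exp (- t)) at_top" for t
        using mda by (simp add: gumbel_mda_def)
    qed
  next
    assume "gumbel_tail (\<lambda>x. 1 / w x) (\<lambda>x. 1 - distr_fun M Z x)"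
    then interpret gumbel_tail "\<lambda>x. 1 / w x" "\<lambda>x. 1 - distr_fun M Z x" .
    have "{x. distr_fun M Z x < 1} = UNIV" using T_pos by auto
    moreover have "(SUP x. ereal x) = \<infinity>"
      by (rule SUP_PInfty) auto
    ultimately show "gumbel_mda w (distr_fun M Z)"
      using scale_pos T_ratio by (simp add: gumbel_mda_def upper_endpoint_def)
  qed
qed

text \<open>\<open>u\<close> is the infimum of the points with \<open>T y < p\<close>, a set that
  \<open>p < T 0\<close> keeps above \<open>0\<close>. Right continuity gives
  \<open>T u \<le> p\<close>; equality can fail at a jump.\<close>

lemma (in gumbel_tail) tail_quantile_exists:
  assumes "0 < p" "p < T 0" and cont: "\<And>x. continuous (at_right x) T"
  obtains u where "T u \<le> p" "\<And>y. y < u \<Longrightarrow> p \<le> T y" "\<And>y. u < y \<Longrightarrow> T y < p"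
proof -
  define B where "B = {y. T y < p}"
  have "\<forall>\<^sub>F y in at_top. T y < p" using T_vanish \<open>0 < p\<close> by (rule order_tendstoD)
  then have "B \<noteq> {}"
    unfolding B_def eventually_at_top_linorder by auto
  have "bdd_below B"
  proof (rule bdd_belowI)
    fix y assume "y \<in> B"
    then show "0 \<le> y" using T_mono[of y 0] assms(2) by (force simp: B_def)
  qed
  have above: "T y < p" if "Inf B < y" for y
    using that \<open>B \<noteq> {}\<close> \<open>bdd_below B\<close> T_mono unfolding B_def
    by (metis (no_types, lifting) cInf_less_iff less_imp_le mem_Collect_eq order_le_less_trans)
  show ?thesis
  proof
    show "T (Inf B) \<le> p"
    proof (rule tendsto_upperbound)
      show "(T \<longlongrightarrow> T (Inf B)) (at_right (Inf B))"
        using cont by (simp add: continuous_within)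
      show "\<forall>\<^sub>F y in at_right (Inf B). T y \<le> p"
        unfolding eventually_at_right_field by (intro exI[of _ "Inf B + 1"]) (auto intro: less_imp_le above)
    qed simp
    show "p \<le> T y" if "y < Inf B" for y
      using cInf_lower[OF _ \<open>bdd_below B\<close>, of y] that unfolding B_def by force
  qed (rule above)
qed

text \<open>\<open>b n\<close> is the quantile at tail level \<open>1 / n\<close>. A jump there is
  harmless: \<open>T (b n) \<le> 1 / n \<le> T (b n - h * a (b n))\<close> for every
  \<open>h > 0\<close> and large \<open>n\<close>, and the outer terms differ asymptotically by the
  factor \<open>exp h\<close>.\<close>

lemma (in gumbel_tail) norming_sequence_exists:
  assumes cont: "\<And>x. continuous (at_right x) T"
  obtains b where "filterlim b at_top sequentially"
    "\<And>x. (\<lambda>n. real n * T (b n + x * a (b n))) \<longlonglongrightarrow> exp (- x)"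
proof -
  \<comment> \<open>The guards leave \<open>b n\<close> arbitrary where \<open>1 / n\<close> is not
    below \<open>T 0\<close>, and at \<open>n = 0\<close>, where \<open>1 / real n\<close> is
    \<open>0\<close>.\<close>
  have "\<exists>u. 1 / real n < T 0 \<longrightarrow> 0 < n \<longrightarrow> T u \<le> 1 / real n \<and> (\<forall>y<u. 1 / real n \<le> T y)" for n
  proof (cases "1 / real n < T 0 \<and> 0 < n")
    case True
    obtain u where "T u \<le> 1 / real n" "\<And>y. y < u \<Longrightarrow> 1 / real n \<le> T y"
      by (rule tail_quantile_exists[of "1 / real n"]) (use True cont in \<open>auto intro: that\<close>)
    then show ?thesis by blast
  qed blast
  then obtain b where b: "\<And>n. 1 / real n < T 0 \<Longrightarrow> 0 < n \<Longrightarrow> T (b n) \<le> 1 / real n"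
    "\<And>n y. 1 / real n < T 0 \<Longrightarrow> 0 < n \<Longrightarrow> y < b n \<Longrightarrow> 1 / real n \<le> T y"
    by metis
  have small: "\<forall>\<^sub>F n in sequentially. 1 / real n < c \<and> 0 < n" if "0 < c" for c
    using order_tendstoD(2)[OF lim_1_over_n that] eventually_gt_at_top[of "0::nat"]
    by eventually_elim simp
  have b_lim: "filterlim b at_top sequentially"
    unfolding filterlim_at_top
  proof
    fix Z
    show "\<forall>\<^sub>F n in sequentially. Z \<le> b n"
      using small[OF T_pos[of Z]] small[OF T_pos[of 0]]
    proof eventually_elim
      case (elim n)
      show ?case
      proof (rule ccontr)
        assume "\<not> Z \<le> b n"
        then show False using b(1)[of n] T_mono[of "b n" Z] elim by linarith
      qed
    qed
  qed
  have one: "(\<lambda>n. real n * T (b n)) \<longlonglongrightarrow> 1"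
  proof (rule order_tendstoI)
    fix l :: real assume "l < 1"
    show "\<forall>\<^sub>F n in sequentially. l < real n * T (b n)"
    proof (cases "l \<le> 0")
      case True
      show ?thesis
        using eventually_gt_at_top[of "0::nat"]
        by eventually_elim (use True T_pos in \<open>auto intro: order_le_less_trans\<close>)
    next
      case False
      \<comment> \<open>Makes \<open>exp h\<close> the square root of \<open>1 / l\<close>, hence
        smaller than \<open>1 / l\<close>.\<close>
      define h where "h = - ln l / 2"
      have h: "0 < h" "exp h < 1 / l"
        using False \<open>l < 1\<close> exp_less_mono[of h "- ln l"] by (auto simp: h_def exp_minus field_simps)
      have "((\<lambda>n. T (b n + (- h) * a (b n)) / T (b n)) \<longlongrightarrow> exp (- (- h))) sequentially"
        by (rule filterlim_compose[OF T_ratio b_lim])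
      then have "\<forall>\<^sub>F n in sequentially. T (b n + (- h) * a (b n)) / T (b n) < 1 / l"
        by (rule order_tendstoD) (use h in simp)
      then show ?thesis
        using small[OF T_pos[of 0]] eventually_compose_filterlim[OF scale_pos b_lim]
      proof eventually_elim
        case (elim n)
        have "1 / real n \<le> T (b n + (- h) * a (b n))"
          using elim h by (intro b(2)) auto
        also have "\<dots> < T (b n) / l"
          using elim(1) T_pos[of "b n"] by (simp add: divide_less_eq)
        finally show ?case using False elim(2) by (simp add: field_simps)
      qed
    qed
  next
    fix u :: real assume "1 < u"
    show "\<forall>\<^sub>F n in sequentially. real n * T (b n) < u"
      using small[OF T_pos[of 0]]
    proof eventually_elim
      case (elim n)
      then have "real n * T (b n) \<le> 1" using b(1)[of n] by (simp add: field_simps)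
      then show ?case using \<open>1 < u\<close> by linarith
    qed
  qed
  have "(\<lambda>n. real n * T (b n + x * a (b n))) \<longlonglongrightarrow> exp (- x)" for x
  proof -
    have "(\<lambda>n. real n * T (b n) * (T (b n + x * a (b n)) / T (b n))) \<longlonglongrightarrow> 1 * exp (- x)"
      by (intro tendsto_mult one filterlim_compose[OF T_ratio b_lim])
    then show ?thesis using T_pos by (simp add: less_imp_neq[THEN not_sym])
  qed
  with b_lim show ?thesis by (rule that)
qed

text \<open>For \<open>p\<close> and \<open>q\<close> in \<open>[-1, 1]\<close> the
  \<open>n\<close>-th powers differ by at most \<open>n * \<bar>p - q\<bar>\<close>. This is applied
  to \<open>h n\<close> and \<open>1 - c / n\<close>, which lies in that interval once
  \<open>n > c\<close>.\<close>

lemma power_tendsto_exp: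
  fixes h :: "nat \<Rightarrow> real"
  assumes h: "\<And>n. 0 \<le> h n" "\<And>n. h n \<le> 1" and lim: "(\<lambda>n. real n * (1 - h n)) \<longlonglongrightarrow> c"
  shows "(\<lambda>n. h n ^ n) \<longlonglongrightarrow> exp (- c)"
proof -
  have "0 \<le> c"
    using lim by (rule LIMSEQ_le_const) (use h in auto)
  obtain n0 where n0: "c < real n0" using reals_Archimedean2 by blast
  have "(\<lambda>n. h n ^ n - (1 + (- c) / real n) ^ n) \<longlonglongrightarrow> 0"
  proof (rule Lim_null_comparison)
    show "(\<lambda>n. \<bar>real n * (1 - h n) - c\<bar>) \<longlonglongrightarrow> 0"
      using tendsto_rabs[OF tendsto_diff[OF lim tendsto_const[of c]]] by simp
    show "\<forall>\<^sub>F n in sequentially. norm (h n ^ n - (1 + (- c) / real n) ^ n) \<le> \<bar>real n * (1 - h n) - c\<bar>"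
      using eventually_gt_at_top[of n0] eventually_gt_at_top[of "0::nat"]
    proof eventually_elim
      case (elim n)
      have "norm (h n ^ n - (1 + (- c) / real n) ^ n) \<le> real n * norm (h n - (1 + (- c) / real n))"
        using h[of n] elim n0 \<open>0 \<le> c\<close>
        by (intro norm_power_diff) (auto simp: abs_le_iff field_simps)
      also have "\<dots> = \<bar>real n * (h n - (1 + (- c) / real n))\<bar>"
        by (simp add: abs_mult)
      also have "real n * (h n - (1 + (- c) / real n)) = - (real n * (1 - h n) - c)"
        using elim by (simp add: field_simps)
      finally show ?case by simp
    qed
  qed
  from tendsto_add[OF this tendsto_exp_limit_sequentially[of "- c"]] show ?thesis by simp
qed

text \<open>Bounds the denominator of \<open>tail_ratio\<close> from below. An atom at the quantile
  \<open>u\<close> decides the case: if the tail at \<open>u\<close> is already below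
  \<open>p\<close>, the event contains \<open>Z \<ge> u\<close>, whose probability is a limit of
  tails taken left of \<open>u\<close>; otherwise it contains \<open>Z > u\<close>.\<close>

lemma (in prob_space) prob_distr_fun_exceeds:
  assumes [measurable]: "Z \<in> borel_measurable M"
    and u: "\<And>y. y < u \<Longrightarrow> p \<le> 1 - distr_fun M Z y" "\<And>y. u < y \<Longrightarrow> 1 - distr_fun M Z y < p"
  shows "p \<le> \<P>(\<omega> in M. 1 - p < distr_fun M Z (Z \<omega>))"
proof -
  note [measurable] = distr_fun_measurable[OF assms(1)]
  show ?thesis
  proof (cases "1 - distr_fun M Z u < p")
    case True
    have "(\<lambda>n. \<P>(\<omega> in M. u - 1 / real (Suc n) < Z \<omega>))
        \<longlonglongrightarrow> prob (\<Inter>n. {\<omega>\<in>space M. u - 1 / real (Suc n) < Z \<omega>})"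
    proof (intro finite_Lim_measure_decseq)
      show "decseq (\<lambda>n. {\<omega>\<in>space M. u - 1 / real (Suc n) < Z \<omega>})"
      proof (intro decseq_SucI Collect_mono impI conjI)
        fix n \<omega> assume "\<omega> \<in> space M \<and> u - 1 / real (Suc (Suc n)) < Z \<omega>"
        moreover have "1 / real (Suc (Suc n)) \<le> 1 / real (Suc n)" by (intro divide_left_mono) auto
        ultimately show "u - 1 / real (Suc n) < Z \<omega>" by linarith
      qed auto
    qed auto
    moreover have "(\<Inter>n. {\<omega>\<in>space M. u - 1 / real (Suc n) < Z \<omega>}) = {\<omega>\<in>space M. u \<le> Z \<omega>}"
    proof (intro equalityI subsetI)
      fix \<omega> assume w: "\<omega> \<in> (\<Inter>n. {\<omega>\<in>space M. u - 1 / real (Suc n) < Z \<omega>})"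
      show "\<omega> \<in> {\<omega>\<in>space M. u \<le> Z \<omega>}"
      proof (rule ccontr)
        assume "\<omega> \<notin> {\<omega>\<in>space M. u \<le> Z \<omega>}"
        then have "0 < u - Z \<omega>" using w by auto
        then obtain n where "1 / real (Suc n) < u - Z \<omega>"
          using reals_Archimedean[of "u - Z \<omega>"] unfolding inverse_eq_divide by blast
        moreover have "u - 1 / real (Suc n) < Z \<omega>" using w by blast
        ultimately show False by linarith
      qed
    qed (auto intro: order.strict_trans2[rotated])
    ultimately have "(\<lambda>n. \<P>(\<omega> in M. u - 1 / real (Suc n) < Z \<omega>)) \<longlonglongrightarrow> \<P>(\<omega> in M. u \<le> Z \<omega>)"
      by simp
    then have "p \<le> \<P>(\<omega> in M. u \<le> Z \<omega>)"
      by (rule LIMSEQ_le_const) (use u(1) in \<open>auto simp: tail_eq_prob\<close>)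
    also have "\<dots> \<le> \<P>(\<omega> in M. 1 - p < distr_fun M Z (Z \<omega>))"
    proof (intro finite_measure_mono Collect_mono impI conjI)
      fix \<omega> assume "\<omega> \<in> space M \<and> u \<le> Z \<omega>"
      then show "1 - p < distr_fun M Z (Z \<omega>)"
        using True u(2)[of "Z \<omega>"] by (cases "Z \<omega> = u") auto
    qed auto
    finally show ?thesis .
  next
    case False
    then have "p \<le> \<P>(\<omega> in M. u < Z \<omega>)" by (simp add: tail_eq_prob)
    also have "\<dots> \<le> \<P>(\<omega> in M. 1 - p < distr_fun M Z (Z \<omega>))"
      by (intro finite_measure_mono Collect_mono) (use u(2) in \<open>force+\<close>)
    finally show ?thesis .
  qed
qed

section \<open>Asymptotic independence\<close>

lemma (in prob_space) tail_continuous_at_right: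
  assumes [measurable]: "Z \<in> borel_measurable M"
  shows "continuous (at_right x) (\<lambda>x. 1 - distr_fun M Z x)"
proof -
  interpret D: real_distribution "distr M borel Z"
    by (rule real_distribution_distr) simp
  show ?thesis
    unfolding distr_fun_def by (intro continuous_intros D.cdf_is_right_cont)
qed

text \<open>The nonstrict \<open>u \<le> X\<close> is forced by atoms:
  \<open>distr_fun M X (X \<omega>) > 1 - s / x\<close> only shows that \<open>X \<omega>\<close> is
  at least the quantile. The form \<open>f u + g v\<close> lets each summand be compared with its
  own marginal, so no relation between \<open>u\<close> and \<open>v\<close> is involved.\<close>

locale joint_tail_dominated = prob_space M +
  X: gumbel_tail aX "\<lambda>x. 1 - distr_fun M X x" + Y: gumbel_tail aY "\<lambda>y. 1 - distr_fun M Y y"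
  for M :: "'m measure" and aX aY X Y +
  fixes f g :: "real \<Rightarrow> real"
  assumes X_measurable [measurable]: "X \<in> borel_measurable M"
    and Y_measurable [measurable]: "Y \<in> borel_measurable M"
    and joint_le: "\<And>u v. 0 < u \<Longrightarrow> 0 < v \<Longrightarrow> \<P>(\<omega> in M. u \<le> X \<omega> \<and> v \<le> Y \<omega>) \<le> f u + g v"
    and f_negligible: "((\<lambda>u. f u / (1 - distr_fun M X u)) \<longlongrightarrow> 0) at_top"
    and g_negligible: "((\<lambda>v. g v / (1 - distr_fun M Y v)) \<longlongrightarrow> 0) at_top"
begin

lemma tail_ratio_tendsto_0:
  assumes "0 < s" "0 < t"
  shows "(tail_ratio M X Y s t \<longlongrightarrow> 0) at_top"
proof (rule order_tendstoI)
  fix l :: real assume "l < 0"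
  moreover have "0 \<le> tail_ratio M X Y s t x" for x
    unfolding tail_ratio_def by (intro divide_nonneg_nonneg) auto
  ultimately show "\<forall>\<^sub>F x in at_top. l < tail_ratio M X Y s t x"
    by (intro always_eventually allI) (rule order.strict_trans2)
next
  fix e :: real assume "0 < e"
  \<comment> \<open>The numerator will be at most \<open>e' * (s + t) / x\<close> and the
    denominator at least \<open>min s t / x\<close>, which makes the quotient at most
    \<open>e / 2\<close>.\<close>
  define e' where "e' = e / 2 * min s t / (s + t)"
  have e': "0 < e'" using assms \<open>0 < e\<close> by (simp add: e'_def)
  define tX where "tX x = 1 - distr_fun M X x" for x
  define tY where "tY x = 1 - distr_fun M Y x" for x
  have "\<forall>\<^sub>F u in at_top. f u / tX u < e' \<and> 0 < u"
    using order_tendstoD(2)[OF f_negligible e'] eventually_gt_at_top[of 0]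
    unfolding tX_def by (rule eventually_conj)
  then obtain U where "\<forall>u\<ge>U. f u / tX u < e' \<and> 0 < u"
    unfolding eventually_at_top_linorder by blast
  then have U: "0 < u" "f u \<le> e' * tX u" if "U \<le> u" for u
    using that X.T_pos[of u] by (auto simp: tX_def divide_less_eq less_imp_le)
  have "\<forall>\<^sub>F v in at_top. g v / tY v < e' \<and> 0 < v"
    using order_tendstoD(2)[OF g_negligible e'] eventually_gt_at_top[of 0]
    unfolding tY_def by (rule eventually_conj)
  then obtain V where "\<forall>v\<ge>V. g v / tY v < e' \<and> 0 < v"
    unfolding eventually_at_top_linorder by blast
  then have V: "0 < v" "g v \<le> e' * tY v" if "V \<le> v" for v
    using that Y.T_pos[of v] by (auto simp: tY_def divide_less_eq less_imp_le)
  have small: "\<forall>\<^sub>F x in at_top. r / x < c" if "0 < c" for r c :: real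
    by (rule order_tendstoD(2)[OF tendsto_divide_0[OF tendsto_const filterlim_at_top_imp_at_infinity[OF filterlim_ident]] that])
  show "\<forall>\<^sub>F x in at_top. tail_ratio M X Y s t x < e"
    using small[OF X.T_pos[of U], of s] small[OF X.T_pos[of 0], of s]
      small[OF Y.T_pos[of V], of t] small[OF Y.T_pos[of 0], of t] eventually_gt_at_top[of 0]
  proof eventually_elim
    case (elim x)
    obtain u where u: "tX u \<le> s / x" "\<And>y. y < u \<Longrightarrow> s / x \<le> tX y" "\<And>y. u < y \<Longrightarrow> tX y < s / x"
      using X.tail_quantile_exists[of "s / x"] elim assms tail_continuous_at_right[OF X_measurable]
      unfolding tX_def by (auto intro: divide_pos_pos)
    obtain v where v: "tY v \<le> t / x" "\<And>y. y < v \<Longrightarrow> t / x \<le> tY y" "\<And>y. v < y \<Longrightarrow> tY y < t / x"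
      using Y.tail_quantile_exists[of "t / x"] elim assms tail_continuous_at_right[OF Y_measurable]
      unfolding tY_def by (auto intro: divide_pos_pos)
    have "U \<le> u"
      using X.T_mono[of u U] u(1) elim(1) unfolding tX_def by linarith
    have "V \<le> v"
      using Y.T_mono[of v V] v(1) elim(3) unfolding tY_def by linarith
    have PX: "s / x \<le> \<P>(\<omega> in M. 1 - s / x < distr_fun M X (X \<omega>))"
      by (rule prob_distr_fun_exceeds[where u = u]) (use u in \<open>simp_all add: tX_def\<close>)
    have PY: "t / x \<le> \<P>(\<omega> in M. 1 - t / x < distr_fun M Y (Y \<omega>))"
      by (rule prob_distr_fun_exceeds[where u = v]) (use v in \<open>simp_all add: tY_def\<close>)
    have min_ge: "min s t / x \<le> min \<P>(\<omega> in M. 1 - s / x < distr_fun M X (X \<omega>))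
        \<P>(\<omega> in M. 1 - t / x < distr_fun M Y (Y \<omega>))"
      using PX PY elim(5) by (auto simp: min_def divide_right_mono intro: order_trans[rotated])
    have "\<P>(\<omega> in M. 1 - s / x < distr_fun M X (X \<omega>) \<and> 1 - t / x < distr_fun M Y (Y \<omega>))
        \<le> \<P>(\<omega> in M. u \<le> X \<omega> \<and> v \<le> Y \<omega>)"
    proof (intro finite_measure_mono Collect_mono impI conjI)
      fix \<omega> assume w: "\<omega> \<in> space M \<and> 1 - s / x < distr_fun M X (X \<omega>) \<and> 1 - t / x < distr_fun M Y (Y \<omega>)"
      then show "u \<le> X \<omega>" "v \<le> Y \<omega>"
        using u(2)[of "X \<omega>"] v(2)[of "Y \<omega>"] unfolding tX_def tY_def by linarith+
    qed auto
    also have "\<dots> \<le> f u + g v"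
      using U(1)[OF \<open>U \<le> u\<close>] V(1)[OF \<open>V \<le> v\<close>] by (rule joint_le)
    also have "\<dots> \<le> e' * (s / x) + e' * (t / x)"
      using U(2)[OF \<open>U \<le> u\<close>] V(2)[OF \<open>V \<le> v\<close>] mult_left_mono[OF u(1), of e'] mult_left_mono[OF v(1), of e'] e'
      by linarith
    also have "\<dots> = e' * (s + t) / x"
      by (simp add: add_divide_distrib distrib_left)
    also have "e' * (s + t) = e / 2 * min s t"
    proof -
      have "s + t \<noteq> 0" using assms by linarith
      from nonzero_eq_divide_eq[OF this, of e' "e / 2 * min s t"] e'_def show ?thesis by blast
    qed
    also have "e / 2 * min s t / x = e / 2 * (min s t / x)" by simp
    finally have num: "\<P>(\<omega> in M. 1 - s / x < distr_fun M X (X \<omega>) \<and> 1 - t / x < distr_fun M Y (Y \<omega>))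
        \<le> e / 2 * (min s t / x)" .
    have pos: "0 < min s t / x" using assms elim(5) by simp
    have "tail_ratio M X Y s t x \<le> (e / 2 * (min s t / x)) / (min s t / x)"
      unfolding tail_ratio_def
      by (rule frac_le[OF mult_nonneg_nonneg[OF _ less_imp_le[OF pos]] num pos min_ge])
        (use \<open>0 < e\<close> in simp)
    also have "\<dots> = e / 2"
      using pos by (intro nonzero_mult_div_cancel_right) linarith
    finally show ?case using \<open>0 < e\<close> by linarith
  qed
qed

text \<open>Inclusion-exclusion writes \<open>1 - H\<close> as the sum of the marginal tails minus
  the joint tail. Along the norming sequences, \<open>n\<close> times the joint tail vanishes, so
  \<open>n * (1 - H)\<close> tends to \<open>exp (- x) + exp (- y)\<close>.\<close>

lemma bivariate_mda_gumbel: "bivariate_mda (\<lambda>x y. gumbel x * gumbel y) (joint_distr_fun M X Y)"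
proof -
  define tX where "tX x = 1 - distr_fun M X x" for x
  define tY where "tY x = 1 - distr_fun M Y x" for x
  obtain b1 where b1: "filterlim b1 at_top sequentially"
    "\<And>x. (\<lambda>n. real n * tX (b1 n + x * aX (b1 n))) \<longlonglongrightarrow> exp (- x)"
    using X.norming_sequence_exists[OF tail_continuous_at_right[OF X_measurable]]
    unfolding tX_def by blast
  obtain b2 where b2: "filterlim b2 at_top sequentially"
    "\<And>x. (\<lambda>n. real n * tY (b2 n + x * aY (b2 n))) \<longlonglongrightarrow> exp (- x)"
    using Y.norming_sequence_exists[OF tail_continuous_at_right[OF Y_measurable]]
    unfolding tY_def by blast
  \<comment> \<open>\<open>bivariate_mda\<close> asks for positive norming at every
    \<open>n\<close>, while \<open>aX (b1 n)\<close> is positive only eventually.\<close>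
  define a1 where "a1 n = (if 0 < aX (b1 n) then aX (b1 n) else 1)" for n
  define a2 where "a2 n = (if 0 < aY (b2 n) then aY (b2 n) else 1)" for n
  define H where "H = joint_distr_fun M X Y"
  have "(\<lambda>n. H (a1 n * x + b1 n) (a2 n * y + b2 n) ^ n) \<longlonglongrightarrow> gumbel x * gumbel y" for x y
  proof -
    define u where "u n = b1 n + x * aX (b1 n)" for n
    define v where "v n = b2 n + y * aY (b2 n)" for n
    have u_top: "filterlim u at_top sequentially"
      unfolding u_def by (rule filterlim_compose[OF X.filterlim_shift b1(1)])
    have v_top: "filterlim v at_top sequentially"
      unfolding v_def by (rule filterlim_compose[OF Y.filterlim_shift b2(1)])
    define J where "J n = \<P>(\<omega> in M. u n < X \<omega> \<and> v n < Y \<omega>)" for n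
    have H_eq: "1 - H (u n) (v n) = tX (u n) + tY (v n) - J n" for n
    proof -
      have "1 - H (u n) (v n) = prob (space M - {\<omega>\<in>space M. X \<omega> \<le> u n \<and> Y \<omega> \<le> v n})"
        unfolding H_def joint_distr_fun_def by (subst prob_compl) auto
      also have "space M - {\<omega>\<in>space M. X \<omega> \<le> u n \<and> Y \<omega> \<le> v n}
          = {\<omega>\<in>space M. u n < X \<omega>} \<union> {\<omega>\<in>space M. v n < Y \<omega>}" by auto
      also have "prob \<dots> = \<P>(\<omega> in M. u n < X \<omega>) + \<P>(\<omega> in M. v n < Y \<omega>)
          - prob ({\<omega>\<in>space M. u n < X \<omega>} \<inter> {\<omega>\<in>space M. v n < Y \<omega>})"
        by (intro measure_Un3) (auto simp: fmeasurable_def less_top[symmetric])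
      also have "{\<omega>\<in>space M. u n < X \<omega>} \<inter> {\<omega>\<in>space M. v n < Y \<omega>} = {\<omega>\<in>space M. u n < X \<omega> \<and> v n < Y \<omega>}"
        by auto
      finally show ?thesis
        by (simp add: tX_def tY_def J_def tail_eq_prob)
    qed
    have nonzero: "tX r \<noteq> 0" "tY r \<noteq> 0" for r
      using X.T_pos[of r] Y.T_pos[of r] unfolding tX_def tY_def by linarith+
    have limX: "(\<lambda>n. real n * tX (u n)) \<longlonglongrightarrow> exp (- x)" and limY: "(\<lambda>n. real n * tY (v n)) \<longlonglongrightarrow> exp (- y)"
      unfolding u_def v_def by (rule b1(2), rule b2(2))
    have "(\<lambda>n. real n * J n) \<longlonglongrightarrow> 0"
    proof (rule tendsto_sandwich[OF _ _ tendsto_const])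
      have "(\<lambda>n. real n * tX (u n) * (f (u n) / tX (u n)) + real n * tY (v n) * (g (v n) / tY (v n)))
          \<longlonglongrightarrow> exp (- x) * 0 + exp (- y) * 0"
        by (intro tendsto_add tendsto_mult limX limY
            filterlim_compose[OF f_negligible[folded tX_def] u_top]
            filterlim_compose[OF g_negligible[folded tY_def] v_top])
      then show "(\<lambda>n. real n * f (u n) + real n * g (v n)) \<longlonglongrightarrow> 0"
        by (simp add: nonzero)
      show "\<forall>\<^sub>F n in sequentially. real n * J n \<le> real n * f (u n) + real n * g (v n)"
        using eventually_compose_filterlim[OF eventually_gt_at_top[of 0] u_top]
          eventually_compose_filterlim[OF eventually_gt_at_top[of 0] v_top]
      proof eventually_elim
        case (elim n)
        have "J n \<le> \<P>(\<omega> in M. u n \<le> X \<omega> \<and> v n \<le> Y \<omega>)"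
          unfolding J_def by (intro finite_measure_mono) auto
        also have "\<dots> \<le> f (u n) + g (v n)" using elim by (rule joint_le)
        finally show ?case
          unfolding distrib_left[symmetric] by (intro mult_left_mono) auto
      qed
    qed (auto simp: J_def)
    then have "(\<lambda>n. real n * tX (u n) + real n * tY (v n) - real n * J n) \<longlonglongrightarrow> exp (- x) + exp (- y) - 0"
      by (intro tendsto_add tendsto_diff limX limY)
    then have "(\<lambda>n. real n * (1 - H (u n) (v n))) \<longlonglongrightarrow> exp (- x) + exp (- y)"
      unfolding H_eq by (simp add: algebra_simps)
    then have "(\<lambda>n. H (u n) (v n) ^ n) \<longlonglongrightarrow> exp (- (exp (- x) + exp (- y)))"
      by (intro power_tendsto_exp) (auto simp: H_def joint_distr_fun_def)
    then have lim: "(\<lambda>n. H (u n) (v n) ^ n) \<longlonglongrightarrow> gumbel x * gumbel y"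
      by (simp add: gumbel_def flip: exp_add)
    show ?thesis
    proof (rule Lim_transform_eventually[OF lim])
      show "\<forall>\<^sub>F n in sequentially. H (u n) (v n) ^ n = H (a1 n * x + b1 n) (a2 n * y + b2 n) ^ n"
        using eventually_compose_filterlim[OF X.scale_pos b1(1)] eventually_compose_filterlim[OF Y.scale_pos b2(1)]
        by eventually_elim (simp add: u_def v_def a1_def a2_def add.commute mult.commute)
    qed
  qed
  moreover have "0 < a1 n \<and> 0 < a2 n" for n by (simp add: a1_def a2_def)
  ultimately show ?thesis
    unfolding bivariate_mda_def H_def by blast
qed

end

section \<open>The random vector\<close>

text \<open>The growth hypothesis of \<open>gumbel_product\<close> is all that regular variation at the upper
  endpoint contributes. The ratio condition forces the denominator to be nonzero eventually, as
  \<open>x / 0 = 0\<close>.\<close>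

lemma (in prob_space) regular_variation_near_one:
  fixes S :: "'a \<Rightarrow> real"
  assumes [measurable]: "S \<in> borel_measurable M" and "0 \<le> \<gamma>"
    and rv: "\<And>s. 0 < s \<Longrightarrow> ((\<lambda>x. \<P>(\<omega> in M. 1 - s / x < S \<omega>) / \<P>(\<omega> in M. 1 - 1 / x < S \<omega>))
       \<longlongrightarrow> s powr \<gamma>) at_top"
  shows "0 < \<tau> \<Longrightarrow> 0 < \<P>(\<omega> in M. 1 - \<tau> < S \<omega>)"
    and "\<exists>l>1. \<forall>\<^sub>F \<tau> in at_right 0. \<P>(\<omega> in M. 1 - l * \<tau> < S \<omega>) \<le> 3 / 2 * \<P>(\<omega> in M. 1 - \<tau> < S \<omega>)"
proof -
  define G where "G \<tau> = \<P>(\<omega> in M. 1 - \<tau> < S \<omega>)" for \<tau>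
  have nonneg: "0 \<le> G \<tau>" for \<tau> by (simp add: G_def)
  have "\<forall>\<^sub>F x in at_top. 1 / 2 < G (1 / x) / G (1 / x)"
    by (rule order_tendstoD(1)[OF rv[of 1, folded G_def]]) simp_all
  then have ev_pos: "\<forall>\<^sub>F x in at_top. 0 < G (1 / x)"
  proof eventually_elim
    case (elim x)
    then have "G (1 / x) \<noteq> 0" by auto
    with nonneg[of "1 / x"] show ?case by linarith
  qed
  show "0 < \<P>(\<omega> in M. 1 - \<tau> < S \<omega>)" if "0 < \<tau>" for \<tau>
  proof -
    have "\<forall>\<^sub>F x in at_top. 0 < G (1 / x) \<and> 1 / \<tau> \<le> x \<and> 0 < x"
      by (intro eventually_conj ev_pos eventually_ge_at_top eventually_gt_at_top)
    then obtain x where x: "0 < G (1 / x)" "1 / \<tau> \<le> x" "0 < x"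
      unfolding eventually_at_top_linorder by blast
    have "1 / x \<le> \<tau>" using x that by (simp add: field_simps)
    then have "G (1 / x) \<le> G \<tau>" unfolding G_def by (intro finite_measure_mono) auto
    with x(1) show ?thesis by (simp add: G_def)
  qed
  \<comment> \<open>This gives \<open>l powr \<gamma> \<le> 5 / 4\<close>, strictly below
    \<open>3 / 2\<close>, so the limit yields the bound eventually. Dividing by
    \<open>\<gamma> + 1\<close> covers \<open>\<gamma> = 0\<close>.\<close>
  define l :: real where "l = (5 / 4) powr (1 / (\<gamma> + 1))"
  have "1 < l" using \<open>0 \<le> \<gamma>\<close> by (simp add: l_def)
  have "l powr \<gamma> = (5 / 4) powr (\<gamma> / (\<gamma> + 1))" by (simp add: l_def powr_powr)
  also have "\<dots> \<le> (5 / 4) powr 1"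
    using \<open>0 \<le> \<gamma>\<close> by (intro powr_mono) auto
  finally have "l powr \<gamma> < 3 / 2" by simp
  then have "\<forall>\<^sub>F x in at_top. G (l / x) / G (1 / x) < 3 / 2"
    using \<open>1 < l\<close> by (intro order_tendstoD(2)[OF rv[of l, folded G_def]]) simp_all
  with ev_pos have "\<forall>\<^sub>F x in at_top. G (l / x) \<le> 3 / 2 * G (1 / x)"
    by eventually_elim (simp add: divide_less_eq)
  then have "\<forall>\<^sub>F \<tau> in at_right 0. G (l * \<tau>) \<le> 3 / 2 * G \<tau>"
    unfolding eventually_at_right_to_top[of "\<lambda>\<tau>. G (l * \<tau>) \<le> 3 / 2 * G \<tau>"] divide_inverse[symmetric]
    unfolding inverse_eq_divide times_divide_eq_right mult_1_right .
  with \<open>1 < l\<close> show "\<exists>l>1. \<forall>\<^sub>F \<tau> in at_right 0.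
      \<P>(\<omega> in M. 1 - l * \<tau> < S \<omega>) \<le> 3 / 2 * \<P>(\<omega> in M. 1 - \<tau> < S \<omega>)"
    unfolding G_def by blast
qed

section \<open>Independence of three variables\<close>

lemma (in prob_space) indep_vars3_prob_eq:
  assumes ind: "indep_vars3 M A X B Y C Z" and S: "S \<in> sets A" "S' \<in> sets B" "S'' \<in> sets C"
  shows "\<P>(\<omega> in M. X \<omega> \<in> S \<and> Y \<omega> \<in> S' \<and> Z \<omega> \<in> S'')
      = \<P>(\<omega> in M. X \<omega> \<in> S) * (\<P>(\<omega> in M. Y \<omega> \<in> S') * \<P>(\<omega> in M. Z \<omega> \<in> S''))" (is ?triple)
    and "\<P>(\<omega> in M. Y \<omega> \<in> S' \<and> Z \<omega> \<in> S'') = \<P>(\<omega> in M. Y \<omega> \<in> S') * \<P>(\<omega> in M. Z \<omega> \<in> S'')" (is ?pair)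
proof -
  define E where "E i = (if i = 0 then X -` S \<inter> space M else if i = 1 then Y -` S' \<inter> space M
    else Z -` S'' \<inter> space M)" for i :: nat
  have ind': "indep_sets (\<lambda>i. if i = 0 then {X -` S \<inter> space M | S. S \<in> sets A}
            else if i = 1 then {Y -` S \<inter> space M | S. S \<in> sets B}
            else {Z -` S \<inter> space M | S. S \<in> sets C}) {0, 1, 2 :: nat}"
    using ind by (simp add: indep_vars3_def)
  have "prob (\<Inter>i\<in>{0, 1, 2}. E i) = (\<Prod>i\<in>{0, 1, 2}. prob (E i))"
    by (rule indep_setsD[OF ind']) (use S in \<open>auto simp: E_def\<close>)
  then show ?triple
    by (simp add: E_def Int_def vimage_def conj_commute conj_left_commute cong: conj_cong)
  have "prob (\<Inter>i\<in>{1, 2}. E i) = (\<Prod>i\<in>{1, 2}. prob (E i))"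
    by (rule indep_setsD[OF ind']) (use S in \<open>auto simp: E_def\<close>)
  then show ?pair
    by (simp add: E_def Int_def vimage_def conj_commute conj_left_commute cong: conj_cong)
qed

text \<open>The rectangle events in \<open>(Y, Z)\<close> form an intersection-stable family
  \<open>P\<close>, independent of \<open>X\<close> by the product formula for three events.
  \<open>Y\<close> and \<open>Z\<close> are measurable for the sigma-algebra that \<open>P\<close>
  generates, so it contains every event \<open>(Y, Z) \<in> D\<close>.\<close>

lemma (in prob_space) indep_vars3_pair_prob_eq:
  assumes ind: "indep_vars3 M A X B Y C Z" and S: "S \<in> sets A" and D: "D \<in> sets (B \<Otimes>\<^sub>M C)"
  shows "\<P>(\<omega> in M. X \<omega> \<in> S \<and> (Y \<omega>, Z \<omega>) \<in> D) = \<P>(\<omega> in M. X \<omega> \<in> S) * \<P>(\<omega> in M. (Y \<omega>, Z \<omega>) \<in> D)"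
proof -
  have [measurable]: "X \<in> measurable M A" "Y \<in> measurable M B" "Z \<in> measurable M C"
    using ind by (auto simp: indep_vars3_def)
  define P where "P = {{\<omega>\<in>space M. Y \<omega> \<in> S' \<and> Z \<omega> \<in> S''} | S' S''. S' \<in> sets B \<and> S'' \<in> sets C}"
  define E where "E = {{\<omega>\<in>space M. X \<omega> \<in> S}}"
  have P_sub: "P \<subseteq> Pow (space M)" by (auto simp: P_def)
  have "indep_set E P"
    unfolding indep_sets2_eq
  proof (intro conjI ballI)
    show "E \<subseteq> events" using S by (auto simp: E_def)
    show "P \<subseteq> events" by (auto simp: P_def)
    fix a b assume "a \<in> E" "b \<in> P"
    then obtain S' S'' where ab: "a = {\<omega>\<in>space M. X \<omega> \<in> S}" "b = {\<omega>\<in>space M. Y \<omega> \<in> S' \<and> Z \<omega> \<in> S''}"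
      and S': "S' \<in> sets B" "S'' \<in> sets C"
      by (auto simp: E_def P_def)
    have "a \<inter> b = {\<omega>\<in>space M. X \<omega> \<in> S \<and> Y \<omega> \<in> S' \<and> Z \<omega> \<in> S''}"
      using ab by auto
    then show "prob (a \<inter> b) = prob a * prob b"
      using indep_vars3_prob_eq[OF ind S S'] ab by simp
  qed
  then have "indep_set (sigma_sets (space M) E) (sigma_sets (space M) P)"
  proof (rule indep_set_sigma_sets)
    show "Int_stable E" by (auto simp: E_def Int_stable_def)
    show "Int_stable P"
    proof (rule Int_stableI)
      fix a b assume "a \<in> P" "b \<in> P"
      then obtain U U' V V' where "a = {\<omega>\<in>space M. Y \<omega> \<in> U \<and> Z \<omega> \<in> V}"
          "b = {\<omega>\<in>space M. Y \<omega> \<in> U' \<and> Z \<omega> \<in> V'}"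
        and s: "U \<in> sets B" "U' \<in> sets B" "V \<in> sets C" "V' \<in> sets C"
        by (auto simp: P_def)
      then have "a \<inter> b = {\<omega>\<in>space M. Y \<omega> \<in> U \<inter> U' \<and> Z \<omega> \<in> V \<inter> V'}" by auto
      with s show "a \<inter> b \<in> P" unfolding P_def by blast
    qed
  qed
  moreover have "{\<omega>\<in>space M. X \<omega> \<in> S} \<in> sigma_sets (space M) E"
    by (auto simp: E_def)
  moreover have "{\<omega>\<in>space M. (Y \<omega>, Z \<omega>) \<in> D} \<in> sigma_sets (space M) P"
  proof -
    define K where "K = sigma (space M) P"
    have K: "space K = space M" "sets K = sigma_sets (space M) P"
      using P_sub by (simp_all add: K_def)
    have "Y \<in> measurable K B"
    proof (rule measurableI)
      show "\<omega> \<in> space K \<Longrightarrow> Y \<omega> \<in> space B" for \<omega>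
        unfolding K by (rule measurable_space) measurable
      fix U assume "U \<in> sets B"
      moreover have "Y -` U \<inter> space K = {\<omega>\<in>space M. Y \<omega> \<in> U \<and> Z \<omega> \<in> space C}"
        unfolding K using measurable_space[OF \<open>Z \<in> measurable M C\<close>] by auto
      ultimately show "Y -` U \<inter> space K \<in> sets K"
        unfolding K(2) by (auto simp: P_def)
    qed
    moreover have "Z \<in> measurable K C"
    proof (rule measurableI)
      show "\<omega> \<in> space K \<Longrightarrow> Z \<omega> \<in> space C" for \<omega>
        unfolding K by (rule measurable_space) measurable
      fix U assume "U \<in> sets C"
      moreover have "Z -` U \<inter> space K = {\<omega>\<in>space M. Y \<omega> \<in> space B \<and> Z \<omega> \<in> U}"
        unfolding K using measurable_space[OF \<open>Y \<in> measurable M B\<close>] by auto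
      ultimately show "Z -` U \<inter> space K \<in> sets K"
        unfolding K(2) by (auto simp: P_def)
    qed
    ultimately have "(\<lambda>\<omega>. (Y \<omega>, Z \<omega>)) \<in> measurable K (B \<Otimes>\<^sub>M C)"
      by (rule measurable_Pair)
    from measurable_sets[OF this D] show ?thesis
      unfolding K by (simp add: vimage_def Int_def conj_commute)
  qed
  ultimately have "prob ({\<omega>\<in>space M. X \<omega> \<in> S} \<inter> {\<omega>\<in>space M. (Y \<omega>, Z \<omega>) \<in> D})
      = \<P>(\<omega> in M. X \<omega> \<in> S) * \<P>(\<omega> in M. (Y \<omega>, Z \<omega>) \<in> D)"
    by (rule indep_setD)
  moreover have "{\<omega>\<in>space M. X \<omega> \<in> S} \<inter> {\<omega>\<in>space M. (Y \<omega>, Z \<omega>) \<in> D}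
      = {\<omega>\<in>space M. X \<omega> \<in> S \<and> (Y \<omega>, Z \<omega>) \<in> D}" by auto
  ultimately show ?thesis by simp
qed

lemma (in prob_space) indep_vars3_indep_var:
  assumes ind: "indep_vars3 M A X B Y C Z"
  shows "indep_var B Y C Z"
proof -
  have [measurable]: "Y \<in> measurable M B" "Z \<in> measurable M C"
    using ind by (auto simp: indep_vars3_def)
  have "indep_set {Y -` S \<inter> space M | S. S \<in> sets B} {Z -` S \<inter> space M | S. S \<in> sets C}"
    unfolding indep_sets2_eq
  proof (intro conjI ballI)
    fix a b assume "a \<in> {Y -` S \<inter> space M | S. S \<in> sets B}" "b \<in> {Z -` S \<inter> space M | S. S \<in> sets C}"
    then obtain S S' where ab: "a = {\<omega>\<in>space M. Y \<omega> \<in> S}" "b = {\<omega>\<in>space M. Z \<omega> \<in> S'}"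
      and S: "S \<in> sets B" "S' \<in> sets C" by blast
    have "a \<inter> b = {\<omega>\<in>space M. Y \<omega> \<in> S \<and> Z \<omega> \<in> S'}" using ab by auto
    then show "prob (a \<inter> b) = prob a * prob b"
      using indep_vars3_prob_eq(2)[OF ind sets.top S] ab by simp
  qed auto
  moreover have "Int_stable {Y -` S \<inter> space M | S. S \<in> sets B}"
    "Int_stable {Z -` S \<inter> space M | S. S \<in> sets C}"
    by (auto intro!: Int_stableI) (metis sets.Int vimage_Int Int_assoc Int_left_commute Int_absorb)+
  ultimately show ?thesis
    unfolding indep_var_eq by (auto intro!: indep_set_sigma_sets)
qed

text \<open>Fubini for the product law of \<open>(R, S)\<close>: at a fixed value
  \<open>s > 0\<close> of \<open>S\<close>, the section of the event is
  \<open>r > x / s\<close>.\<close>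

lemma (in prob_space) prob_product_exceeds:
  assumes ind: "indep_var borel R borel S" and S_pos: "\<And>\<omega>. \<omega> \<in> space M \<Longrightarrow> 0 < (S \<omega> :: real)"
  shows "\<P>(\<omega> in M. x < R \<omega> * S \<omega>) = expectation (\<lambda>\<omega>. 1 - distr_fun M R (x / S \<omega>))"
proof -
  have [measurable]: "R \<in> borel_measurable M" "S \<in> borel_measurable M"
    using ind by (auto dest: indep_var_rv1 indep_var_rv2)
  interpret R: prob_space "distr M borel R" by (rule prob_space_distr) simp
  interpret S: prob_space "distr M borel S" by (rule prob_space_distr) simp
  interpret RS: pair_prob_space "distr M borel R" "distr M borel S" ..
  note [measurable] = distr_fun_measurable[of R]
  define D where "D = {p :: real \<times> real. x < fst p * snd p}"
  have D: "D \<in> sets (borel \<Otimes>\<^sub>M borel)"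
  proof -
    have "{p \<in> space (borel \<Otimes>\<^sub>M borel). x < fst p * snd p} \<in> sets (borel \<Otimes>\<^sub>M (borel :: real measure))"
      by measurable
    then show ?thesis by (simp add: D_def space_pair_measure)
  qed
  have "emeasure M {\<omega>\<in>space M. x < R \<omega> * S \<omega>}
      = emeasure (distr M (borel \<Otimes>\<^sub>M borel) (\<lambda>\<omega>. (R \<omega>, S \<omega>))) D"
    using D by (subst emeasure_distr) (auto simp: D_def intro!: arg_cong[where f = "emeasure M"])
  also have "distr M (borel \<Otimes>\<^sub>M borel) (\<lambda>\<omega>. (R \<omega>, S \<omega>)) = distr M borel R \<Otimes>\<^sub>M distr M borel S"
    using ind unfolding indep_var_distribution_eq by simp
  also have "emeasure \<dots> D = (\<integral>\<^sup>+s. emeasure (distr M borel R) ((\<lambda>r. (r, s)) -` D) \<partial>distr M borel S)"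
    using D by (intro RS.emeasure_pair_measure_alt2) simp
  also have "\<dots> = (\<integral>\<^sup>+\<omega>. emeasure (distr M borel R) ((\<lambda>r. (r, S \<omega>)) -` D) \<partial>M)"
  proof -
    have "(\<lambda>s. emeasure (distr M borel R) ((\<lambda>r. (r, s)) -` D)) \<in> borel_measurable borel"
      using RS.measurable_emeasure_Pair2[of D] D by simp
    then show ?thesis by (subst nn_integral_distr) simp_all
  qed
  also have "\<dots> = (\<integral>\<^sup>+\<omega>. ennreal (1 - distr_fun M R (x / S \<omega>)) \<partial>M)"
  proof (intro nn_integral_cong)
    fix \<omega> assume w: "\<omega> \<in> space M"
    have "(\<lambda>r. (r, S \<omega>)) -` D = {r. x / S \<omega> < r}"
      using S_pos[OF w] by (auto simp: D_def divide_less_eq)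
    then show "emeasure (distr M borel R) ((\<lambda>r. (r, S \<omega>)) -` D) = ennreal (1 - distr_fun M R (x / S \<omega>))"
      by (subst tail_eq_prob, simp) (auto simp: emeasure_distr emeasure_eq_measure vimage_def Int_def conj_commute)
  qed
  also have "\<dots> = ennreal (expectation (\<lambda>\<omega>. 1 - distr_fun M R (x / S \<omega>)))"
    by (intro nn_integral_eq_integral integrable_const_bound[where B = 1] AE_I2)
      (auto simp: distr_fun_eq_prob)
  finally show ?thesis
    by (simp add: emeasure_eq_measure distr_fun_eq_prob)
qed

text \<open>\<open>h\<close> is \<open>zstar\<close> extended to a Borel function on the line; its
  bounds are asked on the open interval in which \<open>W\<close> takes its values.\<close>

locale signed_product = prob_space N + R: gumbel_tail a "\<lambda>x. 1 - distr_fun N R x"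
  for N :: "'n measure" and a :: "real \<Rightarrow> real" and R :: "'n \<Rightarrow> real" +
  fixes W I1 I2 :: "'n \<Rightarrow> real" and \<rho> b \<gamma>1 \<gamma>2 :: real and h :: "real \<Rightarrow> real"
  assumes rho: "0 \<le> \<rho>" "\<rho> < 1"
    and indep: "indep_vars3 N borel (\<lambda>\<omega>. (I1 \<omega>, I2 \<omega>)) borel R borel W"
    and R_pos: "\<omega> \<in> space N \<Longrightarrow> 0 < R \<omega>"
    and W_range: "\<omega> \<in> space N \<Longrightarrow> 0 < W \<omega> \<and> W \<omega> < 1"
    and signs: "\<omega> \<in> space N \<Longrightarrow> I1 \<omega> \<in> {-1, 1} \<and> I2 \<omega> \<in> {-1, 1}"
    and both_positive: "0 < \<P>(\<omega> in N. I1 \<omega> = 1 \<and> I2 \<omega> = 1)"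
    and h_measurable [measurable]: "h \<in> borel_measurable borel"
    and h_bounds: "0 < x \<Longrightarrow> x < 1 \<Longrightarrow> 0 < h x \<and> h x \<le> b \<and> \<rho> * x + h x \<le> 1"
    and b_less: "b < 1"
    and gammas: "0 \<le> \<gamma>1" "0 \<le> \<gamma>2"
    and W_regular: "0 < s \<Longrightarrow> ((\<lambda>x. \<P>(\<omega> in N. 1 - s / x < W \<omega>) / \<P>(\<omega> in N. 1 - 1 / x < W \<omega>))
       \<longlongrightarrow> s powr \<gamma>1) at_top"
    and h_regular: "0 < s \<Longrightarrow> ((\<lambda>x. \<P>(\<omega> in N. 1 - s / x < \<rho> * W \<omega> + h (W \<omega>))
       / \<P>(\<omega> in N. 1 - 1 / x < \<rho> * W \<omega> + h (W \<omega>))) \<longlongrightarrow> s powr \<gamma>2) at_top"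
begin

abbreviation T :: "real \<Rightarrow> real" where "T x \<equiv> 1 - distr_fun N R x"

definition Z :: "'n \<Rightarrow> real" where "Z \<omega> = \<rho> * W \<omega> + h (W \<omega>)"
definition U :: "'n \<Rightarrow> real" where "U \<omega> = R \<omega> * I1 \<omega> * W \<omega>"
definition V :: "'n \<Rightarrow> real" where "V \<omega> = \<rho> * R \<omega> * I1 \<omega> * W \<omega> + R \<omega> * I2 \<omega> * h (W \<omega>)"

lemma measurable_factors [measurable]:
  "R \<in> borel_measurable N" "W \<in> borel_measurable N" "I1 \<in> borel_measurable N" "I2 \<in> borel_measurable N"
proof -
  show "R \<in> borel_measurable N" "W \<in> borel_measurable N"
    using indep by (auto simp: indep_vars3_def)
  have I: "(\<lambda>\<omega>. (I1 \<omega>, I2 \<omega>)) \<in> measurable N (borel \<Otimes>\<^sub>M borel)"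
    using indep by (simp add: indep_vars3_def borel_prod)
  show "I1 \<in> borel_measurable N" "I2 \<in> borel_measurable N"
    using measurable_compose[OF I measurable_fst] measurable_compose[OF I measurable_snd] by simp_all
qed

lemma measurable_U_V [measurable]: "U \<in> borel_measurable N" "V \<in> borel_measurable N" "Z \<in> borel_measurable N"
  unfolding U_def V_def Z_def by measurable

lemma indep_R_W: "indep_var borel R borel W"
  using indep by (rule indep_vars3_indep_var)

lemma indep_R_Z: "indep_var borel R borel Z"
proof -
  have "indep_var borel (id \<circ> R) borel ((\<lambda>x. \<rho> * x + h x) \<circ> W)"
    by (rule indep_var_compose[OF indep_R_W]) measurable
  then show ?thesis by (simp add: Z_def[abs_def] comp_def)
qed

sublocale W: gumbel_product a T N W
proof
  show "\<exists>l>1. \<forall>\<^sub>F \<tau> in at_right 0. prob {\<omega> \<in> space N. 1 - l * \<tau> < W \<omega>}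
      \<le> 3 / 2 * prob {\<omega> \<in> space N. 1 - \<tau> < W \<omega>}"
    by (rule regular_variation_near_one(2)[OF _ gammas(1) W_regular]) measurable
  show "0 < prob {\<omega> \<in> space N. 1 - \<tau> < W \<omega>}" if "0 < \<tau>" for \<tau>
    by (rule regular_variation_near_one(1)[OF _ gammas(1) W_regular that]) measurable
qed (use W_range in \<open>auto intro: less_imp_le\<close>)

sublocale Z: gumbel_product a T N Z
proof
  show "\<exists>l>1. \<forall>\<^sub>F \<tau> in at_right 0. prob {\<omega> \<in> space N. 1 - l * \<tau> < Z \<omega>}
      \<le> 3 / 2 * prob {\<omega> \<in> space N. 1 - \<tau> < Z \<omega>}"
    by (rule regular_variation_near_one(2)[OF _ gammas(2) h_regular[folded Z_def]]) measurable
  show "0 < prob {\<omega> \<in> space N. 1 - \<tau> < Z \<omega>}" if "0 < \<tau>" for \<tau>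
    by (rule regular_variation_near_one(1)[OF _ gammas(2) h_regular[folded Z_def] that]) measurable
  show "0 < Z \<omega>" "Z \<omega> \<le> 1" if "\<omega> \<in> space N" for \<omega>
    using W_range[OF that] h_bounds[of "W \<omega>"] rho unfolding Z_def
    by (auto intro!: add_nonneg_pos)
qed measurable

lemma prob_R_W_exceeds: "\<P>(\<omega> in N. x < R \<omega> * W \<omega>) = W.product_tail x"
  unfolding W.product_tail_def by (rule prob_product_exceeds[OF indep_R_W]) (use W_range in auto)

lemma prob_R_Z_exceeds: "\<P>(\<omega> in N. x < R \<omega> * Z \<omega>) = Z.product_tail x"
  unfolding Z.product_tail_def by (rule prob_product_exceeds[OF indep_R_Z]) (rule Z.S_pos)

lemma prob_signs_and_product:
  assumes [measurable]: "g \<in> borel_measurable borel" and S: "S \<in> sets borel"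
  shows "\<P>(\<omega> in N. (I1 \<omega>, I2 \<omega>) \<in> S \<and> x < R \<omega> * g (W \<omega>))
    = \<P>(\<omega> in N. (I1 \<omega>, I2 \<omega>) \<in> S) * \<P>(\<omega> in N. x < R \<omega> * g (W \<omega>))"
proof -
  define D where "D = {p :: real \<times> real. x < fst p * g (snd p)}"
  have "{p \<in> space (borel \<Otimes>\<^sub>M borel). x < fst p * g (snd p)} \<in> sets (borel \<Otimes>\<^sub>M (borel :: real measure))"
    by measurable
  then have "D \<in> sets (borel \<Otimes>\<^sub>M borel)" by (simp add: D_def space_pair_measure)
  from indep_vars3_pair_prob_eq[OF indep S this] show ?thesis by (simp add: D_def)
qed

section \<open>Marginal tails of the signed vector\<close>

lemma p1_pos: "0 < \<P>(\<omega> in N. I1 \<omega> = 1)"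
proof -
  have "\<P>(\<omega> in N. I1 \<omega> = 1 \<and> I2 \<omega> = 1) \<le> \<P>(\<omega> in N. I1 \<omega> = 1)"
    by (intro finite_measure_mono) auto
  with both_positive show ?thesis by linarith
qed

lemma tail_U:
  assumes "0 \<le> x"
  shows "1 - distr_fun N U x = \<P>(\<omega> in N. I1 \<omega> = 1) * W.product_tail x"
proof -
  have "x < U \<omega> \<longleftrightarrow> (I1 \<omega>, I2 \<omega>) \<in> {1} \<times> UNIV \<and> x < R \<omega> * W \<omega>" if "\<omega> \<in> space N" for \<omega>
  proof -
    have "0 < R \<omega> * W \<omega>" using R_pos[OF that] W_range[OF that] by simp
    then show ?thesis using signs[OF that] assms by (auto simp: U_def)
  qed
  then have "\<P>(\<omega> in N. x < U \<omega>) = \<P>(\<omega> in N. (I1 \<omega>, I2 \<omega>) \<in> {1} \<times> UNIV \<and> x < R \<omega> * W \<omega>)"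
    by (intro arg_cong[where f = prob]) blast
  also have "\<dots> = \<P>(\<omega> in N. (I1 \<omega>, I2 \<omega>) \<in> {1} \<times> UNIV) * \<P>(\<omega> in N. x < R \<omega> * W \<omega>)"
    by (rule prob_signs_and_product[of "\<lambda>x. x"])
      (auto intro!: borel_closed closed_Times)
  finally show ?thesis by (simp add: tail_eq_prob prob_R_W_exceeds)
qed

definition minor_tail :: "real \<Rightarrow> real" where
  "minor_tail x = \<P>(\<omega> in N. \<not> (I1 \<omega> = 1 \<and> I2 \<omega> = 1) \<and> x < V \<omega>)"

lemma tail_V: "1 - distr_fun N V x = \<P>(\<omega> in N. I1 \<omega> = 1 \<and> I2 \<omega> = 1) * Z.product_tail x + minor_tail x"
proof -
  have "\<P>(\<omega> in N. x < V \<omega>) = prob ({\<omega>\<in>space N. (I1 \<omega>, I2 \<omega>) \<in> {(1, 1)} \<and> x < R \<omega> * (\<rho> * W \<omega> + h (W \<omega>))}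
     \<union> {\<omega>\<in>space N. \<not> (I1 \<omega> = 1 \<and> I2 \<omega> = 1) \<and> x < V \<omega>})"
    by (intro arg_cong[where f = prob]) (auto simp: V_def algebra_simps)
  also have "\<dots> = \<P>(\<omega> in N. (I1 \<omega>, I2 \<omega>) \<in> {(1, 1)} \<and> x < R \<omega> * (\<rho> * W \<omega> + h (W \<omega>))) + minor_tail x"
    unfolding minor_tail_def by (intro finite_measure_Union) auto
  also have "\<P>(\<omega> in N. (I1 \<omega>, I2 \<omega>) \<in> {(1, 1)} \<and> x < R \<omega> * (\<rho> * W \<omega> + h (W \<omega>)))
      = \<P>(\<omega> in N. (I1 \<omega>, I2 \<omega>) \<in> {(1, 1)}) * \<P>(\<omega> in N. x < R \<omega> * (\<rho> * W \<omega> + h (W \<omega>)))"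
    by (rule prob_signs_and_product) auto
  also have "\<P>(\<omega> in N. x < R \<omega> * (\<rho> * W \<omega> + h (W \<omega>))) = Z.product_tail x"
    using prob_R_Z_exceeds by (simp add: Z_def)
  finally show ?thesis by (simp add: tail_eq_prob)
qed

text \<open>With a negative sign present, at most one summand of \<open>V\<close> is positive, and
  it is at most \<open>\<rho> * R\<close> or \<open>b * R\<close>. Since \<open>\<rho> < 1\<close>
  and \<open>b < 1\<close>, exceeding \<open>x\<close> forces \<open>R\<close> beyond a fixed
  multiple of \<open>x\<close> larger than \<open>x\<close>.\<close>

lemma minor_tail_le:
  obtains q where "1 < q" "\<And>x. minor_tail x \<le> T (q * x)"
proof -
  define m where "m = max \<rho> b"
  have "0 < b" using h_bounds[of "1/2"] by linarith
  then have m: "0 < m" "m < 1" using rho b_less by (auto simp: m_def)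
  have "minor_tail x \<le> T (1 / m * x)" for x
  proof -
    have "minor_tail x \<le> \<P>(\<omega> in N. 1 / m * x < R \<omega>)"
      unfolding minor_tail_def
    proof (intro finite_measure_mono Collect_mono impI conjI)
      fix \<omega> assume w: "\<omega> \<in> space N \<and> \<not> (I1 \<omega> = 1 \<and> I2 \<omega> = 1) \<and> x < V \<omega>"
      then have pos: "0 < R \<omega>" "0 < W \<omega>" "W \<omega> < 1" "0 < h (W \<omega>)" "h (W \<omega>) \<le> b"
        using R_pos W_range h_bounds[of "W \<omega>"] by auto
      have rW: "0 \<le> \<rho> * W \<omega>" "\<rho> * W \<omega> \<le> \<rho>"
        using pos rho mult_left_mono[of "W \<omega>" 1 \<rho>] by auto
      have "V \<omega> = R \<omega> * (I1 \<omega> * (\<rho> * W \<omega>) + I2 \<omega> * h (W \<omega>))"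
        by (simp add: V_def algebra_simps)
      also have "\<dots> \<le> R \<omega> * m"
        using signs[of \<omega>] w pos rW \<open>0 < m\<close> by (intro mult_left_mono) (auto simp: m_def)
      finally show "1 / m * x < R \<omega>"
        using w m by (simp add: divide_less_eq)
    qed auto
    then show ?thesis by (simp add: tail_eq_prob)
  qed
  then show ?thesis using that[of "1 / m"] m by simp
qed

lemma tail_antimono:
  assumes [measurable]: "Y \<in> borel_measurable N"
  shows "antimono (\<lambda>x. 1 - distr_fun N Y x)"
  by (intro antimonoI) (auto simp: tail_eq_prob intro!: finite_measure_mono)

lemma tail_le_one:
  assumes [measurable]: "Y \<in> borel_measurable N"
  shows "1 - distr_fun N Y x \<le> 1"
  by (simp add: distr_fun_eq_prob)

lemma gumbel_tail_U: "gumbel_tail a (\<lambda>x. 1 - distr_fun N U x)"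
  by (rule gumbel_tail.gumbel_tail_perturb[OF W.gumbel_tail_product _ _ p1_pos, where r = "\<lambda>_. 0"])
    (simp_all add: tail_antimono tail_le_one tail_U)

lemma gumbel_tail_V: "gumbel_tail a (\<lambda>x. 1 - distr_fun N V x)"
proof (rule gumbel_tail.gumbel_tail_perturb[OF Z.gumbel_tail_product _ _ both_positive, where r = minor_tail])
  obtain q where q: "1 < q" "\<And>x. minor_tail x \<le> T (q * x)" using minor_tail_le by blast
  show "((\<lambda>x. minor_tail x / Z.product_tail x) \<longlongrightarrow> 0) at_top"
  proof (rule tendsto_sandwich[OF _ _ tendsto_const Z.T_scaled_over_product_tail[OF q(1)]])
    show "\<forall>\<^sub>F x in at_top. 0 \<le> minor_tail x / Z.product_tail x"
      using Z.product_tail_nonneg by (simp add: minor_tail_def)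
    show "\<forall>\<^sub>F x in at_top. minor_tail x / Z.product_tail x \<le> T (q * x) / Z.product_tail x"
      using Z.product_tail_nonneg q(2) by (intro always_eventually allI divide_right_mono)
  qed
  show "antimono (\<lambda>x. 1 - distr_fun N V x)" "1 - distr_fun N V x \<le> 1" for x
    by (rule tail_antimono, measurable, rule tail_le_one, measurable)
qed (simp_all add: tail_V minor_tail_def)

lemma scaled_tail_negligible:
  assumes "1 < q"
  shows "((\<lambda>x. T (q * x) / (1 - distr_fun N U x)) \<longlongrightarrow> 0) at_top"
    and "((\<lambda>x. T (q * x) / (1 - distr_fun N V x)) \<longlongrightarrow> 0) at_top"
  using W.T_scaled_over_dominating[OF assms p1_pos, of "\<lambda>x. 1 - distr_fun N U x"]
    Z.T_scaled_over_dominating[OF assms both_positive, of "\<lambda>x. 1 - distr_fun N V x"]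
  by (simp_all add: tail_U tail_V minor_tail_def)

text \<open>\<open>\<alpha>\<close> and \<open>\<kappa>\<close> will be \<open>1 / a\<rho>\<close>
  and \<open>a / a\<rho>\<close>. The value \<open>\<rho>\<close> enters \<open>k\<close> through
  \<open>I2 = -1\<close>, where \<open>V\<close> is at most \<open>\<rho> * R\<close> whatever
  \<open>W\<close> is; \<open>I1 = 1\<close> is forced by \<open>u > 0\<close>.\<close>

lemma joint_exceedance_le:
  assumes "\<alpha> < 1" "0 < \<kappa>" "\<kappa> < 1" and z_le: "\<And>x. \<alpha> < x \<Longrightarrow> x < 1 \<Longrightarrow> \<rho> * x + h x \<le> \<kappa>"
  obtains q where "1 < q"
    "\<And>u v. 0 < u \<Longrightarrow> 0 < v \<Longrightarrow> \<P>(\<omega> in N. u \<le> U \<omega> \<and> v \<le> V \<omega>) \<le> T (q * u) + T (q * v)"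
proof -
  define k where "k = max \<alpha> (max \<kappa> \<rho>)"
  have k: "\<alpha> \<le> k" "\<kappa> \<le> k" "\<rho> \<le> k" "0 < k" "k < 1"
    using assms rho by (auto simp: k_def)
  \<comment> \<open>A point strictly between \<open>1\<close> and \<open>1 / k\<close>. Strictness
    of \<open>q * k < 1\<close> turns the nonstrict \<open>u \<le> U \<omega>\<close> into
    \<open>q * u < R \<omega>\<close>.\<close>
  define q where "q = 2 / (1 + k)"
  have q: "1 < q" "q * k < 1" using k by (auto simp: q_def field_simps)
  have "\<P>(\<omega> in N. u \<le> U \<omega> \<and> v \<le> V \<omega>) \<le> T (q * u) + T (q * v)" if "0 < u" "0 < v" for u v
  proof -
    have large: "q * t < r" if "0 < r" "t \<le> r * k" for r t
    proof -
      have "q * t \<le> q * (r * k)" using that q by (intro mult_left_mono) auto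
      also have "\<dots> = r * (q * k)" by simp
      also have "\<dots> < r" using q(2) \<open>0 < r\<close> by simp
      finally show ?thesis .
    qed
    have "\<P>(\<omega> in N. u \<le> U \<omega> \<and> v \<le> V \<omega>) \<le> prob ({\<omega>\<in>space N. q * u < R \<omega>} \<union> {\<omega>\<in>space N. q * v < R \<omega>})"
    proof (intro finite_measure_mono subsetI)
      fix \<omega> assume "\<omega> \<in> {\<omega>\<in>space N. u \<le> U \<omega> \<and> v \<le> V \<omega>}"
      then have w: "\<omega> \<in> space N" "u \<le> U \<omega>" "v \<le> V \<omega>" by auto
      have pos: "0 < R \<omega>" "0 < W \<omega>" "W \<omega> < 1" "0 < h (W \<omega>)"
        using R_pos W_range h_bounds[of "W \<omega>"] w by auto
      have I1: "I1 \<omega> = 1"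
        using signs[OF w(1)] w(2) \<open>0 < u\<close> mult_pos_pos[OF pos(1,2)] by (auto simp: U_def)
      have "u \<le> R \<omega> * k \<or> v \<le> R \<omega> * k"
      proof (cases "I2 \<omega> = 1")
        case True
        have V: "v \<le> R \<omega> * (\<rho> * W \<omega> + h (W \<omega>))"
          using w(3) by (simp add: V_def I1 True algebra_simps)
        show ?thesis
        proof (cases "W \<omega> \<le> \<alpha>")
          case True
          then have "R \<omega> * W \<omega> \<le> R \<omega> * k" using pos k by (intro mult_left_mono) auto
          then show ?thesis using w(2) by (simp add: U_def I1)
        next
          case False
          then have "R \<omega> * (\<rho> * W \<omega> + h (W \<omega>)) \<le> R \<omega> * k"
            using pos k z_le[of "W \<omega>"] by (intro mult_left_mono) auto
          then show ?thesis using V by linarith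
        qed
      next
        case False
        then have "V \<omega> = R \<omega> * (\<rho> * W \<omega> - h (W \<omega>))"
          using signs[OF w(1)] by (auto simp: V_def I1 algebra_simps)
        also have "\<dots> \<le> R \<omega> * k"
          using pos k rho mult_left_mono[of "W \<omega>" 1 \<rho>] by (intro mult_left_mono) auto
        finally show ?thesis using w(3) by linarith
      qed
      then show "\<omega> \<in> {\<omega>\<in>space N. q * u < R \<omega>} \<union> {\<omega>\<in>space N. q * v < R \<omega>}"
        using large pos(1) w(1) by auto
    qed auto
    also have "\<dots> \<le> \<P>(\<omega> in N. q * u < R \<omega>) + \<P>(\<omega> in N. q * v < R \<omega>)"
      by (intro measure_Un_le) auto
    finally show ?thesis by (simp add: tail_eq_prob)
  qed
  with q(1) show ?thesis by (rule that)
qed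

end

section \<open>Transfer to the given vector\<close>

theorem mainTheorem6:
  fixes M :: "'m measure" and X Y :: "'m \<Rightarrow> real"
    and N :: "'n measure" and R W I1 I2 :: "'n \<Rightarrow> real"
    and \<rho> b \<gamma>1 \<gamma>2 :: real and zstar z w :: "real \<Rightarrow> real"
  assumes "prob_space M" and "X \<in> borel_measurable M" and "Y \<in> borel_measurable M"
    and "prob_space N"
    and "0 \<le> \<rho>" and "\<rho> < 1"
    and "distr M borel (\<lambda>\<omega>. (X \<omega>, Y \<omega>)) =
         distr N borel (\<lambda>\<omega>. (R \<omega> * I1 \<omega> * W \<omega>,
                             \<rho> * R \<omega> * I1 \<omega> * W \<omega> + R \<omega> * I2 \<omega> * zstar (W \<omega>)))"
    and "indep_vars3 N borel (\<lambda>\<omega>. (I1 \<omega>, I2 \<omega>)) borel R borel W"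
    and "\<forall>\<omega>\<in>space N. 0 < R \<omega>"
    and "\<forall>\<omega>\<in>space N. W \<omega> \<in> {0<..<1}"
    and "\<forall>\<omega>\<in>space N. I1 \<omega> \<in> {-1, 1} \<and> I2 \<omega> \<in> {-1, 1}"
    and "\<P>(\<omega> in N. I1 \<omega> = 1 \<and> I2 \<omega> = 1) \<in> {0<..1}"
    and "zstar \<in> {0..1} \<rightarrow> {0..1}" and "\<forall>x\<in>{0..1}. 0 < zstar x"
    and "zstar \<in> borel_measurable (restrict_space borel {0..1})"
    and "gumbel_mda w (distr_fun N R)"
    and "upper_endpoint (distr_fun N W) = 1"
    and "z = (\<lambda>x. \<rho> * x + zstar x)"
    and "\<forall>x\<in>{0..1}. z x \<le> 1" and "\<forall>x\<in>{0..1}. zstar x \<le> b" and "b < 1"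
    and "0 \<le> \<gamma>1" and "0 \<le> \<gamma>2"
    and "\<forall>s>0. ((\<lambda>x. \<P>(\<omega> in N. W \<omega> > 1 - s / x) / \<P>(\<omega> in N. W \<omega> > 1 - 1 / x))
                  \<longlongrightarrow> s powr \<gamma>1) at_top"
    and "\<forall>s>0. ((\<lambda>x. \<P>(\<omega> in N. z (W \<omega>) > 1 - s / x) / \<P>(\<omega> in N. z (W \<omega>) > 1 - 1 / x))
                  \<longlongrightarrow> s powr \<gamma>2) at_top"
  shows "gumbel_mda w (distr_fun M X) \<and> gumbel_mda w (distr_fun M Y) \<and>
    ((\<exists>a a\<rho> \<epsilon> c \<gamma>a :: real. \<exists>L :: real \<Rightarrow> real. \<exists>V :: real set.
        0 < a \<and> a \<le> 1 \<and>
        1 < a\<rho> \<and> (\<rho> \<noteq> 0 \<longrightarrow> a\<rho> < a / \<bar>\<rho>\<bar>) \<and> 0 < \<epsilon> \<and> \<epsilon> < 1 \<and>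
        V = {1 / a\<rho> - \<epsilon> .. 1 / a\<rho> + \<epsilon>} \<inter> {0..1} \<and>
        strict_antimono_on V z \<and>
        (\<forall>x\<in>{1 / a\<rho> <.. 1}. z x \<le> a / a\<rho>) \<and>
        0 < c \<and>
        (\<forall>D. compact D \<and> D \<subseteq> {0<..} \<longrightarrow>
           (\<forall>\<^sub>F x in at_top. \<forall>d\<in>D. a / a\<rho> - d / x \<in> z ` V) \<and>
           uniform_limit D
             (\<lambda>x d. (inv_into V z (a / a\<rho> - d / x) - 1 / a\<rho>) / (c * d / x)) (\<lambda>_. 1) at_top) \<and>
        0 \<le> \<gamma>a \<and> locally_bounded_on {0<..} L \<and> slowly_varying_at_0 L \<and>
        (let K1 = - 1 / a\<rho>; K2 = c * a / a\<rho> in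
           ((\<lambda>u. \<P>(\<omega> in N. W \<omega> - 1 / a\<rho> \<in> {K1 * u <..< K2 * u}) / (L u * u powr \<gamma>a))
              \<longlongrightarrow> 1) (at_right 0)))
     \<longrightarrow>
       (\<forall>s>0. \<forall>t>0. (tail_ratio M X Y s t \<longlongrightarrow> 0) at_top) \<and>
       asymptotically_independent M X Y \<and>
       bivariate_mda (\<lambda>x y. gumbel x * gumbel y) (joint_distr_fun M X Y))"
proof -
  interpret M: prob_space M by fact
  interpret N: prob_space N by fact
  note [measurable] = \<open>X \<in> borel_measurable M\<close> \<open>Y \<in> borel_measurable M\<close>
  have R_meas: "R \<in> borel_measurable N"
    using assms(8) by (simp add: indep_vars3_def)
  \<comment> \<open>\<open>zstar\<close> is given as measurable on the unit interval; the value
    \<open>0\<close> outside makes it Borel on the line, and \<open>W\<close> never leaves the open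
    interval.\<close>
  define h where "h x = (if x \<in> {0..1} then zstar x else 0)" for x
  have zstar_h: "zstar x = h x" if "x \<in> {0<..<1}" for x
    using that by (simp add: h_def)
  define a where "a x = 1 / w x" for x
  have h_meas: "h \<in> borel_measurable borel"
  proof -
    have "(\<lambda>x. zstar x * indicator {0..1} x) \<in> borel_measurable borel"
      using assms(15) by (subst (asm) borel_measurable_restrict_space_iff) (simp_all add: mult.commute)
    moreover have "(\<lambda>x. zstar x * indicator {0..1} x) = h"
      by (auto simp: h_def indicator_def)
    ultimately show ?thesis by simp
  qed
  have h_z: "\<rho> * W \<omega> + h (W \<omega>) = z (W \<omega>)" if "\<omega> \<in> space N" for \<omega>
    using zstar_h[of "W \<omega>"] assms(10) that by (simp add: assms(18))
  have h_z_prob: "\<P>(\<omega> in N. c < \<rho> * W \<omega> + h (W \<omega>)) = \<P>(\<omega> in N. c < z (W \<omega>))" for c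
    by (intro arg_cong[where f = N.prob]) (auto simp: h_z)
  interpret S: signed_product N a R W I1 I2 \<rho> b \<gamma>1 \<gamma>2 h
  proof (intro signed_product.intro signed_product_axioms.intro)
    show "gumbel_tail a (\<lambda>x. 1 - distr_fun N R x)"
      using assms(16) unfolding N.gumbel_mda_iff_gumbel_tail[OF R_meas] a_def .
    show "0 < h x \<and> h x \<le> b \<and> \<rho> * x + h x \<le> 1" if "0 < x" "x < 1" for x
    proof -
      have x: "x \<in> {0..1}" using that by simp
      show ?thesis
        using bspec[OF assms(14) x] bspec[OF assms(19) x] bspec[OF assms(20) x] zstar_h[of x] that
        by (simp add: assms(18))
    qed
    show "((\<lambda>x. N.prob {\<omega> \<in> space N. 1 - s / x < \<rho> * W \<omega> + h (W \<omega>)}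
        / N.prob {\<omega> \<in> space N. 1 - 1 / x < \<rho> * W \<omega> + h (W \<omega>)}) \<longlongrightarrow> s powr \<gamma>2) at_top"
      if "0 < s" for s
      unfolding h_z_prob using assms(25) that by simp
    show "((\<lambda>x. N.prob {\<omega> \<in> space N. 1 - s / x < W \<omega>}
        / N.prob {\<omega> \<in> space N. 1 - 1 / x < W \<omega>}) \<longlongrightarrow> s powr \<gamma>1) at_top" if "0 < s" for s
      using assms(24) that by simp
  qed (use assms h_meas in \<open>simp_all\<close>)
  \<comment> \<open>Marginal distribution functions and joint exceedances are probabilities of Borel
    sets in the plane, so equality in law carries them from \<open>N\<close> to
    \<open>M\<close>.\<close>
  have joint_law: "\<P>(\<omega> in M. (X \<omega>, Y \<omega>) \<in> D) = \<P>(\<omega> in N. (S.U \<omega>, S.V \<omega>) \<in> D)"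
    if D: "D \<in> sets (borel :: (real \<times> real) measure)" for D
  proof -
    have eq: "distr M borel (\<lambda>\<omega>. (X \<omega>, Y \<omega>)) = distr N borel (\<lambda>\<omega>. (S.U \<omega>, S.V \<omega>))"
      unfolding assms(7)
    proof (rule distr_cong)
      fix \<omega> assume "\<omega> \<in> space N"
      then show "(R \<omega> * I1 \<omega> * W \<omega>, \<rho> * R \<omega> * I1 \<omega> * W \<omega> + R \<omega> * I2 \<omega> * zstar (W \<omega>)) = (S.U \<omega>, S.V \<omega>)"
        using zstar_h[of "W \<omega>"] assms(10) by (simp add: S.U_def S.V_def)
    qed simp_all
    have "measure (distr M borel (\<lambda>\<omega>. (X \<omega>, Y \<omega>))) D = measure (distr N borel (\<lambda>\<omega>. (S.U \<omega>, S.V \<omega>))) D"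
      unfolding eq ..
    then show ?thesis
      using D by (simp add: measure_distr borel_measurable_Pair vimage_def Int_def conj_commute)
  qed
  have X_law: "distr_fun M X = distr_fun N S.U"
  proof
    fix x
    have "{p :: real \<times> real. fst p \<le> x} \<in> sets borel"
      by (intro borel_closed closed_Collect_le continuous_intros)
    from joint_law[OF this] show "distr_fun M X x = distr_fun N S.U x"
      by (simp add: M.distr_fun_eq_prob N.distr_fun_eq_prob)
  qed
  have Y_law: "distr_fun M Y = distr_fun N S.V"
  proof
    fix x
    have "{p :: real \<times> real. snd p \<le> x} \<in> sets borel"
      by (intro borel_closed closed_Collect_le continuous_intros)
    from joint_law[OF this] show "distr_fun M Y x = distr_fun N S.V x"
      by (simp add: M.distr_fun_eq_prob N.distr_fun_eq_prob)
  qed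
  have tail_X: "gumbel_tail a (\<lambda>x. 1 - distr_fun M X x)"
    unfolding X_law by (rule S.gumbel_tail_U)
  have tail_Y: "gumbel_tail a (\<lambda>x. 1 - distr_fun M Y x)"
    unfolding Y_law by (rule S.gumbel_tail_V)
  have mda: "gumbel_mda w (distr_fun M X)" "gumbel_mda w (distr_fun M Y)"
    using tail_X tail_Y by (simp_all add: M.gumbel_mda_iff_gumbel_tail a_def[abs_def])
  \<comment> \<open>\<open>ar\<close> is the constant \<open>a\<close> of the statement, as
    \<open>a\<close> now denotes \<open>1 / w\<close>.\<close>
  have asym: "(\<forall>s>0. \<forall>t>0. (tail_ratio M X Y s t \<longlongrightarrow> 0) at_top) \<and>
       asymptotically_independent M X Y \<and>
       bivariate_mda (\<lambda>x y. gumbel x * gumbel y) (joint_distr_fun M X Y)"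
    if ar: "0 < ar" "ar \<le> 1" "1 < a\<rho>" and z_le: "\<forall>x\<in>{1 / a\<rho> <.. 1}. z x \<le> ar / a\<rho>" for ar a\<rho>
  proof -
    have "1 / a\<rho> < 1" "0 < ar / a\<rho>" "ar / a\<rho> < 1" using ar by simp_all
    moreover have "\<rho> * x + h x \<le> ar / a\<rho>" if "1 / a\<rho> < x" "x < 1" for x
    proof -
      have "0 < 1 / a\<rho>" using ar by simp
      then have "0 < x" using that by linarith
      moreover have "z x \<le> ar / a\<rho>" using z_le that by simp
      ultimately show ?thesis using zstar_h[of x] that by (simp add: assms(18))
    qed
    ultimately obtain q where q: "1 < q" "\<And>u v. 0 < u \<Longrightarrow> 0 < v \<Longrightarrow>
        \<P>(\<omega> in N. u \<le> S.U \<omega> \<and> v \<le> S.V \<omega>) \<le> S.T (q * u) + S.T (q * v)"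
      using S.joint_exceedance_le[of "1 / a\<rho>" "ar / a\<rho>"] by blast
    interpret J: joint_tail_dominated M a a X Y "\<lambda>u. S.T (q * u)" "\<lambda>v. S.T (q * v)"
    proof (intro joint_tail_dominated.intro joint_tail_dominated_axioms.intro tail_X tail_Y)
      fix u v :: real assume uv: "0 < u" "0 < v"
      have "{p :: real \<times> real. u \<le> fst p} \<inter> {p. v \<le> snd p} \<in> sets borel"
        by (intro borel_closed closed_Int closed_Collect_le continuous_intros)
      from joint_law[OF this] show "\<P>(\<omega> in M. u \<le> X \<omega> \<and> v \<le> Y \<omega>) \<le> S.T (q * u) + S.T (q * v)"
        using q(2)[OF uv] by simp
    qed (use assms S.scaled_tail_negligible[OF q(1)] in \<open>simp_all add: X_law Y_law\<close>)
    show ?thesis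
      using J.tail_ratio_tendsto_0 J.bivariate_mda_gumbel by (simp add: asymptotically_independent_def)
  qed
  show ?thesis
    using mda asym by blast
qed

end
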